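(* Let $n\geq 2$. (a) The virtual braid group $VB_n$ and its pure subgroup $VP_n$ are LERF if and only if $n=2$. (b) The virtual singular braid group $VSG_n$ and its pure subgroup $VSPG_n$ are LERF if and only if $n=2$. (That is, for $n=2$ all of these groups are LERF, and for $n\geq 3$ none of them is.)
   Context: A group $G$ is LERF (subgroup separable) if every finitely generated subgroup of $G$ is an intersection of finite index subgroups of $G$. The virtual braid group $VB_n$ is the group generated by $\sigma_i, v_i$ ($i=1,\ldots,n-1$) with relations: $\sigma_i\sigma_{i+1}\sigma_i=\sigma_{i+1}\sigma_i\sigma_{i+1}$ ($1\le i\le n-2$); $\sigma_i\sigma_j=\sigma_j\sigma_i$ for $|i-j|\geq 2$; $v_iv_{i+1}v_i=v_{i+1}v_iv_{i+1}$ ($1\le i\le n-2$); $v_iv_j=v_jv_i$ for $|i-j|\geq 2$; $v_i^2=1$ ($1\le i\le n-1$); $\sigma_iv_j=v_j\sigma_i$ for $|i-j|\geq 2$; $v_iv_{i+1}\sigma_i=\sigma_{i+1}v_iv_{i+1}$ ($1\le i\le n-2$). The virtual pure braid group $VP_n$ is the kernel of the homomorphism $VB_n\to S_n$ to the symmetric group sending both $\sigma_i$ and $v_i$ to the transposition $(i\ \ i+1)$. The virtual singular braid group $VSG_n$ is the group generated by $\sigma_i,\tau_i,v_i$ ($i=1,\ldots,n-1$) with relations: $v_i^2=1$ and $\sigma_i\tau_i=\tau_i\sigma_i$ for all $i$; for all $i,j$ with $|i-j|=1$: $\sigma_i\sigma_j\sigma_i=\sigma_j\sigma_i\sigma_j$,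 $v_iv_jv_i=v_jv_iv_j$, $v_i\sigma_jv_i=v_j\sigma_iv_j$, $v_i\tau_jv_i=v_j\tau_iv_j$, $\sigma_i\sigma_j\tau_i=\tau_j\sigma_i\sigma_j$; and $g_ih_j=h_jg_i$ for $|i-j|\geq 2$, where $g_i\in\{\sigma_i,\tau_i,v_i\}$ and $h_j\in\{\sigma_j,\tau_j,v_j\}$. The virtual singular pure braid group $VSPG_n$ is the kernel of the homomorphism $VSG_n\to S_n$ sending each of $\sigma_i,\tau_i,v_i$ to the transposition $(i\ \ i+1)$. *)

theory Defs
  imports "HOL-Algebra.Sym_Groups"
begin

section \<open>LERF groups\<close>

definition LERF :: "('a, 'b) monoid_scheme \<Rightarrow> bool"
  where "LERF G \<longleftrightarrow>
    (\<forall>A. A \<subseteq> carrier G \<and> finite A \<longrightarrow>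
      (\<exists>\<K>. (\<forall>K\<in>\<K>. subgroup K G \<and> finite (rcosets\<^bsub>G\<^esub> K)) \<and>
           generate G A = carrier G \<inter> \<Inter>\<K>))"


section \<open>Groups given by generators and relations\<close>

text \<open>A letter \<open>(x, True)\<close> stands for the generator \<open>x\<close> and \<open>(x, False)\<close> for its formal inverse.
  A relation is a pair of words (its two sides).\<close>

type_synonym 'g letters = "('g \<times> bool) list"

definition words :: "'g set \<Rightarrow> 'g letters set"
  where "words S = lists (S \<times> UNIV)"

definition pos :: "'g list \<Rightarrow> 'g letters"
  where "pos xs = map (\<lambda>x. (x, True)) xs"

inductive pres_eq :: "'g set \<Rightarrow> ('g letters \<times> 'g letters) set \<Rightarrow> 'g letters \<Rightarrow> 'g letters \<Rightarrow> bool"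
  for S R where
    refl: "w \<in> words S \<Longrightarrow> pres_eq S R w w"
  | sym: "pres_eq S R u v \<Longrightarrow> pres_eq S R v u"
  | trans: "pres_eq S R u v \<Longrightarrow> pres_eq S R v w \<Longrightarrow> pres_eq S R u w"
  | cancel: "u \<in> words S \<Longrightarrow> v \<in> words S \<Longrightarrow> x \<in> S \<Longrightarrow>
      pres_eq S R (u @ [(x, b), (x, \<not> b)] @ v) (u @ v)"
  | rel: "u \<in> words S \<Longrightarrow> v \<in> words S \<Longrightarrow> (l, r) \<in> R \<Longrightarrow> l \<in> words S \<Longrightarrow> r \<in> words S \<Longrightarrow>
      pres_eq S R (u @ l @ v) (u @ r @ v)"

definition pres_class :: "'g set \<Rightarrow> ('g letters \<times> 'g letters) set \<Rightarrow> 'g letters \<Rightarrow> 'g letters set"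
  where "pres_class S R w = {v. pres_eq S R w v}"

definition presented_group :: "'g set \<Rightarrow> ('g letters \<times> 'g letters) set \<Rightarrow> 'g letters set monoid"
  where "presented_group S R =
    \<lparr> carrier = words S // {(u, v). pres_eq S R u v},
      mult = (\<lambda>X Y. \<Union>u\<in>X. \<Union>v\<in>Y. pres_class S R (u @ v)),
      one = pres_class S R [] \<rparr>"

definition word_value :: "('a, 'b) monoid_scheme \<Rightarrow> ('g \<Rightarrow> 'a) \<Rightarrow> 'g letters \<Rightarrow> 'a"
  where "word_value H f w =
    foldr (\<lambda>(x, b) y. (if b then f x else inv\<^bsub>H\<^esub> (f x)) \<otimes>\<^bsub>H\<^esub> y) w \<one>\<^bsub>H\<^esub>"

text \<open>The homomorphism out of a presented group determined by \<open>f\<close> on the generators; it is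
  meaningful when \<open>f\<close> respects the relations (see \<open>pres_lift_hom\<close> below).\<close>

definition pres_lift :: "('a, 'b) monoid_scheme \<Rightarrow> ('g \<Rightarrow> 'a) \<Rightarrow> 'g letters set \<Rightarrow> 'a"
  where "pres_lift H f X = the_elem (word_value H f ` X)"


section \<open>Virtual braid groups and virtual singular braid groups\<close>

datatype braid_gen = Sig nat | Tau nat | Vir nat

definition VB_gens :: "nat \<Rightarrow> braid_gen set"
  where "VB_gens n = Sig ` {1..n-1} \<union> Vir ` {1..n-1}"

definition VB_rels :: "nat \<Rightarrow> (braid_gen letters \<times> braid_gen letters) set"
  where "VB_rels n =
      {(pos [Sig i, Sig (i+1), Sig i], pos [Sig (i+1), Sig i, Sig (i+1)]) | i. i \<in> {1..n-2}}
    \<union> {(pos [Sig i, Sig j], pos [Sig j, Sig i]) | i j.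
        i \<in> {1..n-1} \<and> j \<in> {1..n-1} \<and> \<bar>int i - int j\<bar> \<ge> 2}
    \<union> {(pos [Vir i, Vir (i+1), Vir i], pos [Vir (i+1), Vir i, Vir (i+1)]) | i. i \<in> {1..n-2}}
    \<union> {(pos [Vir i, Vir j], pos [Vir j, Vir i]) | i j.
        i \<in> {1..n-1} \<and> j \<in> {1..n-1} \<and> \<bar>int i - int j\<bar> \<ge> 2}
    \<union> {(pos [Vir i, Vir i], []) | i. i \<in> {1..n-1}}
    \<union> {(pos [Sig i, Vir j], pos [Vir j, Sig i]) | i j.
        i \<in> {1..n-1} \<and> j \<in> {1..n-1} \<and> \<bar>int i - int j\<bar> \<ge> 2}
    \<union> {(pos [Vir i, Vir (i+1), Sig i], pos [Sig (i+1), Vir i, Vir (i+1)]) | i. i \<in> {1..n-2}}"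

definition VSG_gens :: "nat \<Rightarrow> braid_gen set"
  where "VSG_gens n = Sig ` {1..n-1} \<union> Tau ` {1..n-1} \<union> Vir ` {1..n-1}"

definition VSG_rels :: "nat \<Rightarrow> (braid_gen letters \<times> braid_gen letters) set"
  where "VSG_rels n =
      {(pos [Vir i, Vir i], []) | i. i \<in> {1..n-1}}
    \<union> {(pos [Sig i, Tau i], pos [Tau i, Sig i]) | i. i \<in> {1..n-1}}
    \<union> {(pos [Sig i, Sig j, Sig i], pos [Sig j, Sig i, Sig j]) | i j.
        i \<in> {1..n-1} \<and> j \<in> {1..n-1} \<and> \<bar>int i - int j\<bar> = 1}
    \<union> {(pos [Vir i, Vir j, Vir i], pos [Vir j, Vir i, Vir j]) | i j.
        i \<in> {1..n-1} \<and> j \<in> {1..n-1} \<and> \<bar>int i - int j\<bar> = 1}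
    \<union> {(pos [Vir i, Sig j, Vir i], pos [Vir j, Sig i, Vir j]) | i j.
        i \<in> {1..n-1} \<and> j \<in> {1..n-1} \<and> \<bar>int i - int j\<bar> = 1}
    \<union> {(pos [Vir i, Tau j, Vir i], pos [Vir j, Tau i, Vir j]) | i j.
        i \<in> {1..n-1} \<and> j \<in> {1..n-1} \<and> \<bar>int i - int j\<bar> = 1}
    \<union> {(pos [Sig i, Sig j, Tau i], pos [Tau j, Sig i, Sig j]) | i j.
        i \<in> {1..n-1} \<and> j \<in> {1..n-1} \<and> \<bar>int i - int j\<bar> = 1}
    \<union> {(pos [g i, h j], pos [h j, g i]) | g h i j.
        g \<in> {Sig, Tau, Vir} \<and> h \<in> {Sig, Tau, Vir} \<and>
        i \<in> {1..n-1} \<and> j \<in> {1..n-1} \<and> \<bar>int i - int j\<bar> \<ge> 2}"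

fun gen_perm :: "braid_gen \<Rightarrow> nat \<Rightarrow> nat"
  where "gen_perm (Sig i) = transpose i (i+1)"
  | "gen_perm (Tau i) = transpose i (i+1)"
  | "gen_perm (Vir i) = transpose i (i+1)"

definition VB :: "nat \<Rightarrow> braid_gen letters set monoid"
  where "VB n = presented_group (VB_gens n) (VB_rels n)"

definition VSG :: "nat \<Rightarrow> braid_gen letters set monoid"
  where "VSG n = presented_group (VSG_gens n) (VSG_rels n)"

definition braid_perm :: "nat \<Rightarrow> braid_gen letters set \<Rightarrow> nat \<Rightarrow> nat"
  where "braid_perm n = pres_lift (sym_group n) gen_perm"

definition VP :: "nat \<Rightarrow> braid_gen letters set monoid"
  where "VP n = (VB n)\<lparr>carrier := kernel (VB n) (sym_group n) (braid_perm n)\<rparr>"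

definition VSPG :: "nat \<Rightarrow> braid_gen letters set monoid"
  where "VSPG n = (VSG n)\<lparr>carrier := kernel (VSG n) (sym_group n) (braid_perm n)\<rparr>"


section \<open>Well-definedness\<close>

lemma words_simps [simp]:
  "[] \<in> words S" "a # w \<in> words S \<longleftrightarrow> fst a \<in> S \<and> w \<in> words S"
  "u @ v \<in> words S \<longleftrightarrow> u \<in> words S \<and> v \<in> words S"
  by (cases a; auto simp: words_def)+

lemma pres_eq_words: "pres_eq S R u v \<Longrightarrow> u \<in> words S \<and> v \<in> words S"
  by (induction rule: pres_eq.induct) auto

lemma equiv_pres_eq: "equiv (words S) {(u, v). pres_eq S R u v}"
proof (intro equivI refl_onI symI transI)
  fix u v w
  assume "(u, v) \<in> {(u, v). pres_eq S R u v}" "(v, w) \<in> {(u, v). pres_eq S R u v}"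
  then show "(u, w) \<in> {(u, v). pres_eq S R u v}" by (auto intro: pres_eq.trans)
qed (auto intro: pres_eq.refl pres_eq.sym dest: pres_eq_words)

lemma pres_class_eq_iff:
  assumes "u \<in> words S"
  shows "pres_class S R u = pres_class S R v \<longleftrightarrow> pres_eq S R u v"
proof
  assume "pres_class S R u = pres_class S R v"
  then have "pres_eq S R v u"
    using pres_eq.refl[OF assms, of R] by (auto simp: pres_class_def)
  then show "pres_eq S R u v" by (rule pres_eq.sym)
next
  assume "pres_eq S R u v"
  then show "pres_class S R u = pres_class S R v"
    unfolding pres_class_def using pres_eq.trans pres_eq.sym by blast
qed

lemma pres_class_self: "w \<in> words S \<Longrightarrow> w \<in> pres_class S R w"
  by (simp add: pres_class_def pres_eq.refl)

lemma carrier_presented_group: "carrier (presented_group S R) = pres_class S R ` words S"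
  by (auto simp: presented_group_def quotient_def pres_class_def)

lemma pres_eq_append_left:
  "pres_eq S R u v \<Longrightarrow> w \<in> words S \<Longrightarrow> pres_eq S R (w @ u) (w @ v)"
proof (induction rule: pres_eq.induct)
  case (cancel u v x b)
  then show ?case using pres_eq.cancel[of "w @ u" S v x R b] by simp
next
  case (rel u v l r)
  then show ?case using pres_eq.rel[of "w @ u" S v l r R] by simp
next
  case (trans u v w')
  then show ?case using pres_eq.trans by blast
qed (auto intro: pres_eq.refl pres_eq.sym)

lemma pres_eq_append_right:
  "pres_eq S R u v \<Longrightarrow> w \<in> words S \<Longrightarrow> pres_eq S R (u @ w) (v @ w)"
proof (induction rule: pres_eq.induct)
  case (cancel u v x b)
  then show ?case using pres_eq.cancel[of u S "v @ w" x R b] by simp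
next
  case (rel u v l r)
  then show ?case using pres_eq.rel[of u S "v @ w" l r R] by simp
next
  case (trans u v w')
  then show ?case using pres_eq.trans by blast
qed (auto intro: pres_eq.refl pres_eq.sym)

lemma pres_eq_append:
  assumes "pres_eq S R u u'" "pres_eq S R v v'"
  shows "pres_eq S R (u @ v) (u' @ v')"
proof (rule pres_eq.trans)
  show "pres_eq S R (u @ v) (u' @ v)"
    using assms by (auto intro: pres_eq_append_right dest: pres_eq_words)
  show "pres_eq S R (u' @ v) (u' @ v')"
    using assms by (auto intro: pres_eq_append_left dest: pres_eq_words)
qed

lemma mult_presented_group:
  assumes "u \<in> words S" "v \<in> words S"
  shows "pres_class S R u \<otimes>\<^bsub>presented_group S R\<^esub> pres_class S R v = pres_class S R (u @ v)"
proof -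
  have eq: "pres_class S R (u' @ v') = pres_class S R (u @ v)"
    if "u' \<in> pres_class S R u" "v' \<in> pres_class S R v" for u' v'
  proof -
    have "pres_eq S R (u @ v) (u' @ v')"
      using that by (simp add: pres_class_def pres_eq_append)
    then show ?thesis
      using assms pres_class_eq_iff[of "u @ v" S R "u' @ v'"] by simp
  qed
  have ne: "pres_class S R u \<noteq> {}" "pres_class S R v \<noteq> {}"
    using assms pres_class_self by blast+
  have "(\<Union>u'\<in>pres_class S R u. \<Union>v'\<in>pres_class S R v. pres_class S R (u' @ v')) =
    (\<Union>u'\<in>pres_class S R u. \<Union>v'\<in>pres_class S R v. pres_class S R (u @ v))"
    using eq by (intro SUP_cong) simp_all
  then show ?thesis using ne by (simp add: presented_group_def)
qed

lemma one_presented_group: "\<one>\<^bsub>presented_group S R\<^esub> = pres_class S R []"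
  by (simp add: presented_group_def)

definition inv_word :: "'g letters \<Rightarrow> 'g letters"
  where "inv_word w = rev (map (\<lambda>(x, b). (x, \<not> b)) w)"

lemma inv_word_in_words: "w \<in> words S \<Longrightarrow> inv_word w \<in> words S"
  by (auto simp: inv_word_def words_def)

lemma inv_word_left: "w \<in> words S \<Longrightarrow> pres_eq S R (inv_word w @ w) []"
proof (induction w)
  case (Cons a w)
  obtain x b where a: "a = (x, b)" by fastforce
  have "pres_eq S R (inv_word w @ [(x, \<not> b), (x, \<not> \<not> b)] @ w) (inv_word w @ w)"
    using Cons.prems a by (intro pres_eq.cancel inv_word_in_words) auto
  moreover have "inv_word (a # w) @ a # w = inv_word w @ [(x, \<not> b), (x, \<not> \<not> b)] @ w"
    by (simp add: inv_word_def a)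
  ultimately show ?case using Cons by (simp, metis pres_eq.trans)
qed (simp add: inv_word_def pres_eq.refl)

lemma group_presented_group: "group (presented_group S R)"
proof (rule groupI)
  fix X assume "X \<in> carrier (presented_group S R)"
  then obtain w where w: "w \<in> words S" "X = pres_class S R w"
    by (auto simp: carrier_presented_group)
  have "pres_class S R (inv_word w) \<otimes>\<^bsub>presented_group S R\<^esub> X = \<one>\<^bsub>presented_group S R\<^esub>"
    using w inv_word_left[OF w(1), of R] inv_word_in_words[OF w(1)]
    by (simp add: mult_presented_group one_presented_group pres_class_eq_iff)
  then show "\<exists>Y\<in>carrier (presented_group S R).
      Y \<otimes>\<^bsub>presented_group S R\<^esub> X = \<one>\<^bsub>presented_group S R\<^esub>"
    using inv_word_in_words[OF w(1)] by (auto simp: carrier_presented_group)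
qed (auto simp: carrier_presented_group mult_presented_group one_presented_group)

context group
begin

lemma word_value_closed:
  "f ` S \<subseteq> carrier G \<Longrightarrow> w \<in> words S \<Longrightarrow> word_value G f w \<in> carrier G"
  by (induction w) (auto simp: word_value_def)

lemma word_value_append:
  "f ` S \<subseteq> carrier G \<Longrightarrow> u \<in> words S \<Longrightarrow> v \<in> words S \<Longrightarrow>
    word_value G f (u @ v) = word_value G f u \<otimes> word_value G f v"
proof (induction u)
  case Nil
  then show ?case using word_value_closed[of f S v] by (simp add: word_value_def)
next
  case (Cons a u)
  then have "f (fst a) \<in> carrier G"
    "word_value G f u \<in> carrier G" "word_value G f v \<in> carrier G"
    using word_value_closed[of f S] by auto
  then show ?case using Cons by (cases a) (auto simp: word_value_def m_assoc)
qed

lemma word_value_cong: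
  assumes f: "f ` S \<subseteq> carrier G"
    and R: "\<And>l r. (l, r) \<in> R \<Longrightarrow> word_value G f l = word_value G f r"
  shows "pres_eq S R u v \<Longrightarrow> word_value G f u = word_value G f v"
proof (induction rule: pres_eq.induct)
  case (cancel u v x b)
  then have "f x \<in> carrier G" using f by auto
  then have "word_value G f [(x, b), (x, \<not> b)] = \<one>" by (simp add: word_value_def)
  then show ?case using cancel f word_value_closed[OF f]
    by (simp add: word_value_append[OF f] del: append.simps)
next
  case (rel u v l r)
  then show ?case using R[of l r] by (simp add: word_value_append[OF f])
qed auto

lemma pres_lift_class:
  assumes "f ` S \<subseteq> carrier G" "\<And>l r. (l, r) \<in> R \<Longrightarrow> word_value G f l = word_value G f r"
    and "w \<in> words S"
  shows "pres_lift G f (pres_class S R w) = word_value G f w"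
proof -
  have "word_value G f v = word_value G f w" if "v \<in> pres_class S R w" for v
    using that word_value_cong[OF assms(1,2), of R w v] by (simp add: pres_class_def)
  then have "word_value G f ` pres_class S R w = {word_value G f w}"
    using pres_class_self[OF assms(3), of R] by blast
  then show ?thesis by (simp add: pres_lift_def)
qed

lemma pres_lift_hom:
  assumes "f ` S \<subseteq> carrier G" "\<And>l r. (l, r) \<in> R \<Longrightarrow> word_value G f l = word_value G f r"
  shows "pres_lift G f \<in> hom (presented_group S R) G"
proof (rule homI)
  fix X assume "X \<in> carrier (presented_group S R)"
  then obtain u where "u \<in> words S" "X = pres_class S R u"
    by (auto simp: carrier_presented_group)
  then show "pres_lift G f X \<in> carrier G"
    by (simp add: pres_lift_class[OF assms] word_value_closed[OF assms(1)])
next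
  fix X Y assume "X \<in> carrier (presented_group S R)" "Y \<in> carrier (presented_group S R)"
  then obtain u v where "u \<in> words S" "X = pres_class S R u" "v \<in> words S" "Y = pres_class S R v"
    by (auto simp: carrier_presented_group)
  then show "pres_lift G f (X \<otimes>\<^bsub>presented_group S R\<^esub> Y) = pres_lift G f X \<otimes> pres_lift G f Y"
    by (simp add: mult_presented_group pres_lift_class[OF assms] word_value_append[OF assms(1)])
qed

end

lemma gen_perm_closed: "gen_perm ` VSG_gens n \<subseteq> carrier (sym_group n)"
  by (auto simp: VSG_gens_def sym_group_carrier intro!: permutes_swap_id)

lemma gen_perm_closed_VB: "gen_perm ` VB_gens n \<subseteq> carrier (sym_group n)"
  by (auto simp: VB_gens_def sym_group_carrier intro!: permutes_swap_id)

lemma word_value_pos: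
  "word_value (sym_group n) gen_perm (pos xs) = foldr (\<lambda>x p. gen_perm x \<circ> p) xs id"
  by (induction xs) (auto simp: word_value_def pos_def sym_group_mult sym_group_one)

lemma transpose_braid:
  assumes "\<bar>int i - int j\<bar> = 1"
  shows "transpose i (Suc i) \<circ> (transpose j (Suc j) \<circ> transpose i (Suc i)) =
    transpose j (Suc j) \<circ> (transpose i (Suc i) \<circ> transpose j (Suc j))"
  using assms by (auto simp: fun_eq_iff transpose_def)

lemma transpose_far:
  assumes "\<bar>int i - int j\<bar> \<ge> 2"
  shows "transpose i (Suc i) \<circ> transpose j (Suc j) = transpose j (Suc j) \<circ> transpose i (Suc i)"
  using assms by (auto simp: fun_eq_iff transpose_def)

lemma word_value_pos_Nil: "word_value (sym_group n) gen_perm [] = id"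
  by (simp add: word_value_def sym_group_one)

lemma VSG_rels_perm:
  assumes "(l, r) \<in> VSG_rels n"
  shows "word_value (sym_group n) gen_perm l = word_value (sym_group n) gen_perm r"
  using assms unfolding VSG_rels_def
  by (auto simp: word_value_pos word_value_pos_Nil transpose_braid transpose_far)

lemma VB_rels_perm:
  assumes "(l, r) \<in> VB_rels n"
  shows "word_value (sym_group n) gen_perm l = word_value (sym_group n) gen_perm r"
proof -
  have "transpose i (Suc i) \<circ> (transpose (Suc i) (Suc (Suc i)) \<circ> transpose i (Suc i)) =
    transpose (Suc i) (Suc (Suc i)) \<circ> (transpose i (Suc i) \<circ> transpose (Suc i) (Suc (Suc i)))" for i :: nat
    using transpose_braid[of i "Suc i"] by simp
  then show ?thesis
    using assms unfolding VB_rels_def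
    by (auto simp: word_value_pos word_value_pos_Nil transpose_far)
qed

lemma group_VB: "group (VB n)" and group_VSG: "group (VSG n)"
  by (simp_all add: VB_def VSG_def group_presented_group)

lemma braid_perm_hom_VB: "braid_perm n \<in> hom (VB n) (sym_group n)"
  unfolding braid_perm_def VB_def
  by (rule group.pres_lift_hom[OF sym_group_is_group gen_perm_closed_VB VB_rels_perm])

lemma braid_perm_hom_VSG: "braid_perm n \<in> hom (VSG n) (sym_group n)"
  unfolding braid_perm_def VSG_def
  by (rule group.pres_lift_hom[OF sym_group_is_group gen_perm_closed VSG_rels_perm])

lemma braid_perm_gen_VB:
  assumes "x \<in> VB_gens n"
  shows "braid_perm n (pres_class (VB_gens n) (VB_rels n) (pos [x])) = gen_perm x"
proof -
  have "pos [x] \<in> words (VB_gens n)" using assms by (simp add: pos_def)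
  from group.pres_lift_class[OF sym_group_is_group gen_perm_closed_VB VB_rels_perm this]
  show ?thesis by (simp add: braid_perm_def word_value_pos)
qed

lemma braid_perm_gen_VSG:
  assumes "x \<in> VSG_gens n"
  shows "braid_perm n (pres_class (VSG_gens n) (VSG_rels n) (pos [x])) = gen_perm x"
proof -
  have "pos [x] \<in> words (VSG_gens n)" using assms by (simp add: pos_def)
  from group.pres_lift_class[OF sym_group_is_group gen_perm_closed VSG_rels_perm this]
  show ?thesis by (simp add: braid_perm_def word_value_pos)
qed

lemma group_VP: "group (VP n)" and group_VSPG: "group (VSPG n)"
proof -
  have "group_hom (VB n) (sym_group n) (braid_perm n)"
    "group_hom (VSG n) (sym_group n) (braid_perm n)"
    by (auto simp: group_hom_def group_hom_axioms_def group_VB group_VSG sym_group_is_group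
        braid_perm_hom_VB braid_perm_hom_VSG)
  then show "group (VP n)" "group (VSPG n)"
    unfolding VP_def VSPG_def
    by (auto intro!: subgroup.subgroup_is_group group_hom.subgroup_kernel group_VB group_VSG)
qed

end

theory Submission
  imports Defs "HOL-Algebra.Group_Action"
begin

text \<open>For \<open>n \<ge> 3\<close>, put \<open>\<lambda>\<^sub>1\<^sub>2 = v\<^sub>1 \<sigma>\<^sub>1\<close>, \<open>\<lambda>\<^sub>2\<^sub>1 = \<sigma>\<^sub>1 v\<^sub>1\<close>, and so on. The elements
  \<open>a = \<lambda>\<^sub>1\<^sub>3\<inverse> \<lambda>\<^sub>3\<^sub>2\<close>, \<open>b = \<lambda>\<^sub>1\<^sub>2 \<lambda>\<^sub>1\<^sub>3\<close>, \<open>c = \<lambda>\<^sub>2\<^sub>3 \<lambda>\<^sub>1\<^sub>3\<close>, \<open>d = \<lambda>\<^sub>1\<^sub>3\<inverse> \<lambda>\<^sub>2\<^sub>1\<close> of the pure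
  group satisfy \<open>[a,b] = [b,c] = [c,d] = 1\<close>. With \<open>x = d\<inverse> b d\<close>, these relations alone force
  \<open>x\<inverse> c b\<inverse> x\<close> into every finite index subgroup that contains \<open>c b\<inverse>\<close>, \<open>c\<^sup>2 x\<^sup>-\<^sup>3\<close> and \<open>a d\<close>.
  It is not in the subgroup generated by them: the pure group maps to \<open>BS(2,3) \<times> BS(2,3)\<close> so
  that the three generators become diagonal, and \<open>x\<inverse> c b\<inverse> x\<close> does not.

  For \<open>n = 2\<close> the groups are subgroups of \<open>(\<int> \<times> \<int>) * \<int>/2\<close>. Given a finitely
  generated subgroup \<open>H\<close> and \<open>g \<notin> H\<close>, let \<open>F\<close> be the finite set of cosets of \<open>H\<close> visited by the
  words for the generators of \<open>H\<close> and for \<open>g\<close>. For suitable \<open>m\<close> the set \<open>F\<close> injects into the quotient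
  of its \<open>\<int> \<times> \<int>\<close>-orbits by \<open>m\<int> \<times> m\<int>\<close>. This quotient is finite, and the stabilizer of the base point
  separates \<open>g\<close> from \<open>H\<close>.\<close>

section \<open>Separability and finite index subgroups\<close>

text \<open>The largest possible family for \<open>A\<close> consists of all finite index subgroups
  containing \<open>A\<close>, so LERF amounts to excluding one element \<open>g\<close> at a
  time.\<close>

lemma (in group) LERF_iff_separates:
  "LERF G \<longleftrightarrow> (\<forall>A g. A \<subseteq> carrier G \<longrightarrow> finite A \<longrightarrow> g \<in> carrier G - generate G A \<longrightarrow>
    (\<exists>K. subgroup K G \<and> finite (rcosets K) \<and> A \<subseteq> K \<and> g \<notin> K))" (is "?L \<longleftrightarrow> ?R")
proof
  assume L: ?L
  show ?R
  proof (intro allI impI)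
    fix A g assume A: "A \<subseteq> carrier G" "finite A" and g: "g \<in> carrier G - generate G A"
    obtain \<K> where \<K>: "\<forall>K\<in>\<K>. subgroup K G \<and> finite (rcosets K)"
      "generate G A = carrier G \<inter> \<Inter>\<K>" using L[unfolded LERF_def, rule_format, of A] A by auto
    then obtain K where "K \<in> \<K>" "g \<notin> K" using g by blast
    moreover have "A \<subseteq> K" using \<K>(2) \<open>K \<in> \<K>\<close> generate.incl[of _ A G] by auto
    ultimately show "\<exists>K. subgroup K G \<and> finite (rcosets K) \<and> A \<subseteq> K \<and> g \<notin> K"
      using \<K> by blast
  qed
next
  assume R: ?R
  show ?L
    unfolding LERF_def
  proof (intro allI impI)
    fix A assume A: "A \<subseteq> carrier G \<and> finite A"
    define \<K> where "\<K> = {K. subgroup K G \<and> finite (rcosets K) \<and> A \<subseteq> K}"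
    have sub: "A \<subseteq> carrier G" "finite A" using A by simp_all
    have "generate G A \<subseteq> K" if "K \<in> \<K>" for K
      using that generate_subgroup_incl[of A K] by (simp add: \<K>_def)
    then have "generate G A \<subseteq> carrier G \<inter> \<Inter>\<K>" using generate_incl[OF sub(1)] by blast
    moreover have "g \<in> generate G A" if g: "g \<in> carrier G" "g \<in> \<Inter>\<K>" for g
    proof (rule ccontr)
      assume "g \<notin> generate G A"
      then obtain K where "K \<in> \<K>" "g \<notin> K"
        using R[rule_format, OF sub, of g] g(1) by (auto simp: \<K>_def)
      with g(2) show False by blast
    qed
    then have "carrier G \<inter> \<Inter>\<K> \<subseteq> generate G A" by blast
    ultimately have "generate G A = carrier G \<inter> \<Inter>\<K>" by (rule equalityI)
    moreover have "\<forall>K\<in>\<K>. subgroup K G \<and> finite (rcosets K)" by (simp add: \<K>_def)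
    ultimately show "\<exists>\<K>. (\<forall>K\<in>\<K>. subgroup K G \<and> finite (rcosets K)) \<and>
        generate G A = carrier G \<inter> \<Inter>\<K>" by blast
  qed
qed

section \<open>Pulling finite index subgroups back along homomorphisms\<close>

lemma (in group_hom) subgroup_preimage:
  assumes "subgroup K H"
  shows "subgroup {x \<in> carrier G. h x \<in> K} G"
  by (rule G.subgroupI) (use assms in \<open>auto simp: subgroup.m_closed subgroup.m_inv_closed
    subgroup.one_closed intro: exI[of _ "\<one>\<^bsub>G\<^esub>"]\<close>)

text \<open>Every coset of the preimage of \<open>K\<close> is the preimage of a coset of
  \<open>K\<close>, so the index cannot grow.\<close>

lemma (in group_hom) finite_rcosets_preimage:
  assumes K: "subgroup K H" and fin: "finite (rcosets\<^bsub>H\<^esub> K)"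
  shows "finite (rcosets\<^bsub>G\<^esub> {x \<in> carrier G. h x \<in> K})" (is "finite (rcosets\<^bsub>G\<^esub> ?K)")
proof (rule finite_subset)
  show "rcosets\<^bsub>G\<^esub> ?K \<subseteq> (\<lambda>R. {x \<in> carrier G. h x \<in> R}) ` (rcosets\<^bsub>H\<^esub> K)"
  proof
    fix X assume "X \<in> rcosets\<^bsub>G\<^esub> ?K"
    then obtain a where a: "a \<in> carrier G" "X = ?K #>\<^bsub>G\<^esub> a" by (auto simp: RCOSETS_def)
    have "X \<subseteq> carrier G" using a G.r_coset_subset_G[of ?K a] by auto
    moreover have "x \<in> X \<longleftrightarrow> h x \<in> K #>\<^bsub>H\<^esub> h a" if "x \<in> carrier G" for x
      using that a subgroup.rcos_module[OF subgroup_preimage[OF K] G.group_axioms a(1) that]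
        subgroup.rcos_module[OF K H.group_axioms, of "h a" "h x"] by simp
    ultimately have "X = {x \<in> carrier G. h x \<in> K #>\<^bsub>H\<^esub> h a}" by blast
    moreover have "K #>\<^bsub>H\<^esub> h a \<in> rcosets\<^bsub>H\<^esub> K" using a by (auto simp: RCOSETS_def)
    ultimately show "X \<in> (\<lambda>R. {x \<in> carrier G. h x \<in> R}) ` (rcosets\<^bsub>H\<^esub> K)" by blast
  qed
qed (use fin in simp)

text \<open>The images of \<open>A\<close> and \<open>g\<close> are separated in \<open>H\<close>
  and the separating subgroup is pulled back. Injectivity keeps \<open>h g\<close> outside the
  subgroup generated by the image of \<open>A\<close>.\<close>

lemma (in group_hom) LERF_inj_hom:
  assumes inj: "inj_on h (carrier G)" and LERF: "LERF H"
  shows "LERF G"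
  unfolding G.LERF_iff_separates
proof (intro allI impI)
  fix A g assume A: "A \<subseteq> carrier G" "finite A" and g: "g \<in> carrier G - generate G A"
  have "h g \<notin> generate H (h ` A)"
  proof
    assume "h g \<in> generate H (h ` A)"
    then obtain y where "y \<in> generate G A" "h g = h y"
      using generate_img[OF A(1)] by auto
    then show False
      using g inj G.generate_incl[OF A(1)] by (metis Diff_iff inj_onD subsetD)
  qed
  moreover have "h ` A \<subseteq> carrier H" "finite (h ` A)" "h g \<in> carrier H" using A g by auto
  ultimately obtain K where K: "subgroup K H" "finite (rcosets\<^bsub>H\<^esub> K)" "h ` A \<subseteq> K" "h g \<notin> K"
    using LERF unfolding H.LERF_iff_separates by blast
  show "\<exists>K. subgroup K G \<and> finite (rcosets\<^bsub>G\<^esub> K) \<and> A \<subseteq> K \<and> g \<notin> K"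
    by (rule exI[of _ "{x \<in> carrier G. h x \<in> K}"])
      (use A K subgroup_preimage finite_rcosets_preimage in auto)
qed

lemma (in group) LERF_subgroup:
  assumes "LERF G" "subgroup H G"
  shows "LERF (G\<lparr>carrier := H\<rparr>)"
proof -
  have "group_hom (G\<lparr>carrier := H\<rparr>) G id"
    using assms subgroup.subgroup_is_group[OF assms(2)] subgroup.subset[OF assms(2)]
    by (auto simp: group_hom_def group_hom_axioms_def hom_def)
  then show ?thesis using group_hom.LERF_inj_hom[OF _ _ assms(1)] by fastforce
qed

section \<open>Powers under conjugation and commutation\<close>

lemma (in group) cancel_inv_left [simp]:
  assumes "x \<in> carrier G" "y \<in> carrier G"
  shows "x \<otimes> (inv x \<otimes> y) = y" "inv x \<otimes> (x \<otimes> y) = y"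
  using assms m_assoc[of x "inv x" y] m_assoc[of "inv x" x y] by simp_all

text \<open>The hypothesis \<open>rx\<close> makes \<open>x\<close> a conjugate of \<open>b\<close>
  by \<open>r\<close>, and conjugation is a homomorphism. In this form without inverses, the case
  \<open>x = b\<close> yields commutation with powers.\<close>

lemma (in group) conj_pow:
  assumes r: "r \<in> carrier G" and b: "b \<in> carrier G" and x: "x \<in> carrier G"
    and rx: "r \<otimes> x = b \<otimes> r"
  shows "r \<otimes> x [^] (k::int) = b [^] k \<otimes> r"
proof -
  have x_eq: "x = inv r \<otimes> (b \<otimes> r)"
    unfolding rx[symmetric] using r x by (rule cancel_inv_left(2)[symmetric])
  have "group_hom G G (\<lambda>y. inv r \<otimes> (y \<otimes> r))"
    using r by (auto simp: group_hom_def group_hom_axioms_def hom_def group_axioms m_assoc)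
  then have "x [^] k = inv r \<otimes> (b [^] k \<otimes> r)"
    unfolding x_eq using b by (rule group_hom.hom_int_pow[symmetric])
  then show ?thesis using r b by simp
qed

lemma (in group) commute_pow:
  assumes "b \<in> carrier G" "c \<in> carrier G" "b \<otimes> c = c \<otimes> b"
  shows "b [^] (i::int) \<otimes> c [^] (j::int) = c [^] j \<otimes> b [^] i"
proof -
  have "c \<otimes> b [^] i = b [^] i \<otimes> c" using assms by (intro conj_pow) simp_all
  then show ?thesis using assms by (intro conj_pow) simp_all
qed

section \<open>A non-separable subgroup\<close>

text \<open>Pigeonhole: two of the cosets of \<open>K\<close> by powers of \<open>b\<close>
  coincide, and the difference of their exponents works.\<close>

lemma (in group) finite_index_pow:
  assumes K: "subgroup K G" "finite (rcosets K)" and b: "b \<in> carrier G"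
  obtains m :: int where "m > 0" "b [^] m \<in> K"
proof -
  have "range (\<lambda>k::nat. K #> b [^] k) \<subseteq> rcosets K" using b by (auto simp: RCOSETS_def)
  then have "\<not> inj (\<lambda>k::nat. K #> b [^] k)"
    using K(2) by (meson finite_imageD finite_subset infinite_UNIV_nat)
  then obtain i j :: nat where ij: "i < j" "K #> b [^] i = K #> b [^] j"
    unfolding inj_def by (metis linorder_neqE_nat)
  have "b [^] j \<in> K #> b [^] i"
    using ij b K by (simp add: rcos_self)
  then have "b [^] j \<otimes> inv (b [^] i) \<in> K"
    using b subgroup.rcos_module[OF K(1) group_axioms, of "b [^] i" "b [^] j"] by simp
  moreover have "b [^] j \<otimes> inv (b [^] i) = b [^] (int j - int i)"
    by (simp only: int_pow_diff[OF b] int_pow_int)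
  ultimately show thesis using that[of "int j - int i"] ij by simp
qed

text \<open>In every finite quotient of \<open>BS(2,3)\<close> the order of \<open>c\<close> is coprime to 6, so \<open>x\<close>, which has
  \<open>x\<^sup>3 = c\<^sup>2\<close>, becomes a power of \<open>c\<close>. The lemma runs this argument on the coset of \<open>K\<close>,
  where \<open>b\<close> and \<open>c\<close> act alike and \<open>x\<close> is a conjugate of \<open>b\<close> by an element of \<open>K\<close>.\<close>

lemma (in group) mem_finite_index:
  assumes K: "subgroup K G" "finite (rcosets K)"
    and G: "b \<in> carrier G" "c \<in> carrier G" "x \<in> carrier G"
    and bc: "b \<otimes> c = c \<otimes> b" and cx: "x \<otimes> c = c \<otimes> x" and rx: "r \<otimes> x = b \<otimes> r"
    and inK: "c \<otimes> inv b \<in> K" "c [^] (2::int) \<otimes> inv (x [^] (3::int)) \<in> K" "r \<in> K"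
  shows "inv x \<otimes> (c \<otimes> inv b) \<otimes> x \<in> K"
proof -
  note Kc [simp] = subgroup.mem_carrier[OF K(1)] and Km = subgroup.m_closed[OF K(1)]
    and Ki = subgroup.m_inv_closed[OF K(1)] and Kp = subgroup_int_pow_closed[OF K(1)]
  note [simp] = G
  have r [simp]: "r \<in> carrier G" using inK by simp
  \<comment> \<open>\<open>I\<close> is a subgroup of \<int>. The facts below show that the same
    exponents bring powers of \<open>b\<close>, \<open>c\<close> and \<open>x\<close> into
    \<open>K\<close>, so a single modulus governs all three.\<close>
  define I where "I = {k::int. b [^] k \<in> K}"
  have quot: "u \<in> K \<longleftrightarrow> v \<in> K" if "u \<otimes> inv v \<in> K" "u \<in> carrier G" "v \<in> carrier G" for u v
  proof -
    have "u = (u \<otimes> inv v) \<otimes> v" "v = inv (u \<otimes> inv v) \<otimes> u"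
      using that by (simp_all add: m_assoc inv_mult_group)
    then show ?thesis using that Km Ki by metis
  qed
  have c_iff: "c [^] k \<in> K \<longleftrightarrow> k \<in> I" for k :: int
  proof -
    have "inv b \<otimes> c = c \<otimes> inv b" using bc by (metis G(1,2) inv_closed inv_solve_left inv_solve_right m_assoc m_closed)
    then have "(c \<otimes> inv b) [^] k = c [^] k \<otimes> inv (b [^] k)"
      by (simp add: int_pow_mult_distrib int_pow_inv)
    then show ?thesis using Kp[OF inK(1), of k] quot unfolding I_def by simp
  qed
  have x_iff: "x [^] k \<in> K \<longleftrightarrow> k \<in> I" for k :: int
  proof -
    have rk: "r \<otimes> x [^] k = b [^] k \<otimes> r" using rx by (intro conj_pow) auto
    have "x [^] k = inv r \<otimes> (b [^] k \<otimes> r)" "b [^] k = r \<otimes> x [^] k \<otimes> inv r"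
      unfolding rk[symmetric] using rk by (simp_all add: m_assoc inv_solve_left inv_solve_right)
    then show ?thesis using inK(3) Km Ki unfolding I_def by (metis mem_Collect_eq)
  qed
  have I_diff: "j - k \<in> I" if "j \<in> I" "k \<in> I" for j k
    using that Km Ki unfolding I_def by (simp add: int_pow_diff)
  have I_mult: "k * j \<in> I" if "k \<in> I" for j k
    using that Kp[of "b [^] k" j] unfolding I_def by (simp add: int_pow_pow)
  have cx_pow: "x [^] i \<otimes> c [^] j = c [^] j \<otimes> x [^] i" for i j :: int
    using cx by (intro commute_pow) auto
  have cx_quot: "c [^] (2 * k) \<otimes> inv (x [^] (3 * k)) \<in> K" for k :: int
  proof -
    have neg: "x [^] (- 3 :: int) = inv (x [^] (3::int))" "x [^] (- (3 * k)) = inv (x [^] (3 * k))"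
      using int_pow_neg[of x 3] int_pow_neg[of x "3 * k"] by simp_all
    have "x [^] (- 3 :: int) \<otimes> c [^] (2::int) = c [^] (2::int) \<otimes> x [^] (- 3::int)" by (rule cx_pow)
    then have "(c [^] (2::int) \<otimes> x [^] (-3::int)) [^] k = (c [^] (2::int)) [^] k \<otimes> (x [^] (-3::int)) [^] k"
      by (simp add: int_pow_mult_distrib)
    then show ?thesis using Kp[OF inK(2), of k]
      by (simp add: int_pow_pow neg flip: neg(1))
  qed
  \<comment> \<open>Here \<open>2 * k\<close> is read as an exponent of \<open>c\<close> and
    \<open>3 * k\<close> as one of \<open>x\<close>.\<close>
  have I23: "2 * k \<in> I \<longleftrightarrow> 3 * k \<in> I" for k
    using cx_quot[of k] quot c_iff x_iff by (metis G(2,3) int_pow_closed)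
  obtain m where m: "m > 0" "m \<in> I" "\<And>k. k > 0 \<Longrightarrow> k \<in> I \<Longrightarrow> m \<le> k"
  proof -
    obtain m0 where m0: "m0 > 0" "m0 \<in> I" using finite_index_pow[OF K G(1)] unfolding I_def by blast
    define P where "P k \<longleftrightarrow> k > 0 \<and> int k \<in> I" for k
    have "P (nat m0)" using m0 by (simp add: P_def)
    then have "P (LEAST k. P k)" and "\<And>k. P k \<Longrightarrow> (LEAST k. P k) \<le> k"
      by (auto intro: LeastI Least_le)
    then show thesis using that[of "int (LEAST k. P k)"]
      by (auto simp: P_def) (metis int_eq_iff nat_le_iff zero_less_nat_eq less_imp_le nat_0_le)
  qed
  \<comment> \<open>If \<open>m = 3 * k\<close>, then \<open>2 * k\<close> lies in \<open>I\<close>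
    too, hence so does the difference \<open>k\<close>, contrary to minimality. Thus 3 is invertible
    modulo \<open>m\<close>.\<close>
  have third: "m \<noteq> 3 * k" for k
  proof -
    have *: "k \<in> I" if "2 * k \<in> I" for k using I_diff[of "3 * k" "2 * k"] I23[of k] that by simp
    show "m \<noteq> 3 * k" using *[of k] I23[of k] m by force
  qed
  have "\<exists>u v. 1 = 3 * u + m * v"
  proof -
    have "m mod 3 \<noteq> 0" using third[of "m div 3"] by auto
    then have "m mod 3 = 1 \<or> m mod 3 = 2" by auto
    then show ?thesis
    proof
      assume "m mod 3 = 1"
      then have "1 = 3 * (- (m div 3)) + m * 1" using mult_div_mod_eq[of 3 m] by simp
      then show ?thesis by blast
    next
      assume "m mod 3 = 2"
      then have "1 = 3 * (m div 3 + 1) + m * (- 1)" using mult_div_mod_eq[of 3 m] by simp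
      then show ?thesis by blast
    qed
  qed
  then obtain u v where uv: "1 = 3 * u + m * v" by blast
  \<comment> \<open>Up to the factor \<open>y\<close>, which will lie in \<open>K\<close> because
    \<open>1 = 3 * u + m * v\<close>, the element \<open>x\<close> is the power
    \<open>c [^] (2 * u)\<close>. Powers of \<open>c\<close> commute with
    \<open>c \<otimes> inv b\<close>, so conjugation by \<open>x\<close> may be replaced by
    conjugation by \<open>y\<close>.\<close>
  define y where "y = c [^] (2 * (- u)) \<otimes> x"
  have "x = x [^] (3 * u) \<otimes> x [^] (m * v)"
    using uv by (metis G(3) int_pow_1 int_pow_mult)
  then have "y = (c [^] (2 * (- u)) \<otimes> inv (x [^] (3 * (- u)))) \<otimes> x [^] (m * v)"
    by (simp add: y_def m_assoc int_pow_neg)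
  moreover have "x [^] (m * v) \<in> K" using x_iff I_mult m by blast
  ultimately have yK: "y \<in> K" using cx_quot[of "- u"] Km by simp
  have "c [^] k \<otimes> (c \<otimes> inv b) = (c \<otimes> inv b) \<otimes> c [^] k" for k :: int
    using conj_pow[of "c \<otimes> inv b" c c k] bc
    by (smt (verit) G(1,2) inv_closed inv_solve_left inv_solve_right m_assoc m_closed)
  then have *: "inv (c [^] k) \<otimes> (c \<otimes> inv b) \<otimes> c [^] k = c \<otimes> inv b" for k :: int
    by (metis G(1,2) int_pow_closed inv_closed inv_solve_left m_assoc m_closed)
  have "inv y \<otimes> (c \<otimes> inv b) \<otimes> y
      = inv x \<otimes> (inv (c [^] (2 * (- u))) \<otimes> (c \<otimes> inv b) \<otimes> c [^] (2 * (- u))) \<otimes> x"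
    by (simp add: y_def inv_mult_group m_assoc)
  also have "\<dots> = inv x \<otimes> (c \<otimes> inv b) \<otimes> x" by (simp only: *)
  finally show ?thesis using yK inK(1) Km Ki by metis
qed

lemma (in group) not_LERF:
  assumes G: "b \<in> carrier G" "c \<in> carrier G" "x \<in> carrier G" "r \<in> carrier G"
    and rels: "b \<otimes> c = c \<otimes> b" "x \<otimes> c = c \<otimes> x" "r \<otimes> x = b \<otimes> r"
    and notin: "inv x \<otimes> (c \<otimes> inv b) \<otimes> x \<notin>
      generate G {c \<otimes> inv b, c \<otimes> c \<otimes> inv (x \<otimes> x \<otimes> x), r}"
  shows "\<not> LERF G"
proof
  let ?A = "{c \<otimes> inv b, c \<otimes> c \<otimes> inv (x \<otimes> x \<otimes> x), r}"
  have pow: "c [^] (2::int) = c \<otimes> c" "x [^] (3::int) = x \<otimes> x \<otimes> x"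
    using int_pow_mult[of c 1 1] int_pow_mult[of x 2 1] int_pow_mult[of x 1 1] G by simp_all
  assume "LERF G"
  moreover have "?A \<subseteq> carrier G" "finite ?A" using G by auto
  moreover have "inv x \<otimes> (c \<otimes> inv b) \<otimes> x \<in> carrier G - generate G ?A" using G notin by simp
  ultimately obtain K where "subgroup K G" "finite (rcosets K)" "?A \<subseteq> K"
    "inv x \<otimes> (c \<otimes> inv b) \<otimes> x \<notin> K"
    unfolding LERF_iff_separates by blast
  then show False using mem_finite_index[of K b c x r] G rels pow by simp
qed

section \<open>Relations among the pure generators on three strands\<close>

lemma (in group) virtual_braid_relations:
  assumes [simp]: "s1 \<in> carrier G" "s2 \<in> carrier G" "v1 \<in> carrier G" "v2 \<in> carrier G"
    and vv: "v1 \<otimes> v1 = \<one>" "v2 \<otimes> v2 = \<one>"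
    and vvv: "v2 \<otimes> (v1 \<otimes> v2) = v1 \<otimes> (v2 \<otimes> v1)"
    and sss: "s1 \<otimes> (s2 \<otimes> s1) = s2 \<otimes> (s1 \<otimes> s2)"
    and svv: "s2 \<otimes> (v1 \<otimes> v2) = v1 \<otimes> (v2 \<otimes> s1)"
  defines "l12 \<equiv> v1 \<otimes> s1" and "l21 \<equiv> s1 \<otimes> v1" and "l23 \<equiv> v2 \<otimes> s2" and "l32 \<equiv> s2 \<otimes> v2"
    and "l13 \<equiv> v2 \<otimes> (v1 \<otimes> (s1 \<otimes> v2))"
  shows "l12 \<otimes> (l13 \<otimes> l23) = l23 \<otimes> (l13 \<otimes> l12)"
    and "l13 \<otimes> (l12 \<otimes> l32) = l32 \<otimes> (l12 \<otimes> l13)"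
    and "l21 \<otimes> (l23 \<otimes> l13) = l13 \<otimes> (l23 \<otimes> l21)"
proof -
  \<comment> \<open>Products are kept nested to the right, so a relation between triples must also
    be available with a tail \<open>w\<close> in order to rewrite inside longer words.\<close>
  have ext: "x \<otimes> (y \<otimes> (z \<otimes> w)) = x' \<otimes> (y' \<otimes> (z' \<otimes> w))"
    if "x \<otimes> (y \<otimes> z) = x' \<otimes> (y' \<otimes> z')" "{x, y, z, x', y', z', w} \<subseteq> carrier G" for x y z x' y' z' w
    using arg_cong[OF that(1), of "\<lambda>u. u \<otimes> w"] that(2) by (simp add: m_assoc)
  have v_cancel: "v1 \<otimes> (v1 \<otimes> w) = w" "v2 \<otimes> (v2 \<otimes> w) = w" if "w \<in> carrier G" for w
    using m_assoc[of v1 v1 w] m_assoc[of v2 v2 w] vv that by simp_all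
  have "s1 \<otimes> (v2 \<otimes> v1) = v2 \<otimes> (v1 \<otimes> (v1 \<otimes> (v2 \<otimes> (s1 \<otimes> (v2 \<otimes> v1)))))"
    by (simp add: v_cancel)
  also have "\<dots> = v2 \<otimes> (v1 \<otimes> (s2 \<otimes> (v1 \<otimes> (v2 \<otimes> (v2 \<otimes> v1)))))"
    using ext[OF svv, of "v2 \<otimes> v1"] by simp
  also have "\<dots> = v2 \<otimes> (v1 \<otimes> s2)" by (simp add: v_cancel vv)
  finally have svv': "s1 \<otimes> (v2 \<otimes> v1) = v2 \<otimes> (v1 \<otimes> s2)" .
  note rewr = m_assoc vv v_cancel vvv sss svv svv' ext[OF vvv] ext[OF sss] ext[OF svv] ext[OF svv']
  have closed [simp]: "l12 \<in> carrier G" "l21 \<in> carrier G" "l23 \<in> carrier G" "l32 \<in> carrier G"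
    "l13 \<in> carrier G" by (simp_all add: l12_def l21_def l23_def l32_def l13_def)
  show 1: "l12 \<otimes> (l13 \<otimes> l23) = l23 \<otimes> (l13 \<otimes> l12)"
    by (simp add: l12_def l13_def l23_def rewr)
  \<comment> \<open>Conjugation by \<open>v2\<close> exchanges the strand indices 2 and 3;
    conjugation by \<open>v1\<close> below exchanges 1 and 2. The last two relations thus arise from
    the first by renaming strands.\<close>
  have conj2: "v2 \<otimes> (l12 \<otimes> v2) = l13" "v2 \<otimes> (l13 \<otimes> v2) = l12" "v2 \<otimes> (l23 \<otimes> v2) = l32"
    by (simp_all add: l12_def l13_def l23_def l32_def rewr)
  have conj1: "v1 \<otimes> (l12 \<otimes> v1) = l21" "v1 \<otimes> (l13 \<otimes> v1) = l23" "v1 \<otimes> (l23 \<otimes> v1) = l13"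
  proof -
    show "v1 \<otimes> (l12 \<otimes> v1) = l21" by (simp add: l12_def l21_def rewr)
    show *: "v1 \<otimes> (l13 \<otimes> v1) = l23" by (simp add: l13_def l23_def rewr)
    show "v1 \<otimes> (l23 \<otimes> v1) = l13" by (simp add: *[symmetric] m_assoc vv v_cancel)
  qed
  have conj_triple: "(v \<otimes> (x \<otimes> v)) \<otimes> ((v \<otimes> (y \<otimes> v)) \<otimes> (v \<otimes> (z \<otimes> v))) = v \<otimes> ((x \<otimes> (y \<otimes> z)) \<otimes> v)"
    if "v \<otimes> v = \<one>" "{v, x, y, z} \<subseteq> carrier G" for v x y z
  proof -
    have "v \<otimes> (v \<otimes> w) = w" if "w \<in> carrier G" for w
      using m_assoc[of v v w] \<open>v \<otimes> v = \<one>\<close> \<open>{v, x, y, z} \<subseteq> carrier G\<close> that by simp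
    then show ?thesis using that by (simp add: m_assoc)
  qed
  show "l13 \<otimes> (l12 \<otimes> l32) = l32 \<otimes> (l12 \<otimes> l13)"
    using conj_triple[of v2 l12 l13 l23] conj_triple[of v2 l23 l13 l12] 1 vv by (simp add: conj2)
  show "l21 \<otimes> (l23 \<otimes> l13) = l13 \<otimes> (l23 \<otimes> l21)"
    using conj_triple[of v1 l12 l13 l23] conj_triple[of v1 l23 l13 l12] 1 vv by (simp add: conj1)
qed

text \<open>Brings the mixed relation as given in \<open>VSG_rels\<close> into the form of
  \<open>VB_rels\<close>, so that one argument serves both families.\<close>

lemma (in group) virtual_mixed_relation:
  assumes [simp]: "s1 \<in> carrier G" "s2 \<in> carrier G" "v1 \<in> carrier G" "v2 \<in> carrier G"
    and vv: "v1 \<otimes> v1 = \<one>" "v2 \<otimes> v2 = \<one>"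
    and vsv: "v1 \<otimes> (s2 \<otimes> v1) = v2 \<otimes> (s1 \<otimes> v2)"
  shows "s2 \<otimes> (v1 \<otimes> v2) = v1 \<otimes> (v2 \<otimes> s1)"
proof -
  have "v1 \<otimes> (s2 \<otimes> (v1 \<otimes> v2)) = v2 \<otimes> (s1 \<otimes> (v2 \<otimes> v2))"
    using arg_cong[OF vsv, of "\<lambda>u. u \<otimes> v2"] by (simp add: m_assoc)
  then have "v1 \<otimes> (v1 \<otimes> (s2 \<otimes> (v1 \<otimes> v2))) = v1 \<otimes> (v2 \<otimes> s1)" by (simp add: vv)
  then show ?thesis using m_assoc[of v1 v1 "s2 \<otimes> (v1 \<otimes> v2)"] vv by simp
qed

text \<open>These are the defining relations of the right-angled Artin group of the path on the four
  vertices \<open>a\<close>, \<open>b\<close>, \<open>c\<close>, \<open>d\<close>. Each is one of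
  the triple relations after a factor \<open>l13\<close> has been cancelled or appended.\<close>

lemma (in group) path_of_commuting_elements:
  assumes [simp]: "l12 \<in> carrier G" "l21 \<in> carrier G" "l23 \<in> carrier G" "l32 \<in> carrier G"
    "l13 \<in> carrier G"
    and rels: "l12 \<otimes> (l13 \<otimes> l23) = l23 \<otimes> (l13 \<otimes> l12)"
      "l13 \<otimes> (l12 \<otimes> l32) = l32 \<otimes> (l12 \<otimes> l13)"
      "l21 \<otimes> (l23 \<otimes> l13) = l13 \<otimes> (l23 \<otimes> l21)"
  defines "a \<equiv> inv l13 \<otimes> l32" and "b \<equiv> l12 \<otimes> l13" and "c \<equiv> l23 \<otimes> l13" and "d \<equiv> inv l13 \<otimes> l21"
  shows "a \<otimes> b = b \<otimes> a" and "b \<otimes> c = c \<otimes> b" and "c \<otimes> d = d \<otimes> c"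
proof -
  show "a \<otimes> b = b \<otimes> a"
    by (simp add: a_def b_def m_assoc flip: rels(2))
  have "b \<otimes> c = (l12 \<otimes> (l13 \<otimes> l23)) \<otimes> l13" by (simp add: b_def c_def m_assoc)
  also have "\<dots> = c \<otimes> b" by (simp only: rels(1)) (simp add: b_def c_def m_assoc)
  finally show "b \<otimes> c = c \<otimes> b" .
  show "c \<otimes> d = d \<otimes> c" by (simp add: c_def d_def m_assoc rels(3))
qed

text \<open>The conjugate \<open>x\<close> commutes with \<open>c\<close> since both
  \<open>b\<close> and \<open>d\<close> do. With \<open>r = a \<otimes> d\<close>, the relation
  \<open>r \<otimes> x = b \<otimes> r\<close> holds because \<open>a\<close> commutes with
  \<open>b\<close>. This is the input of \<open>not_LERF\<close>.\<close>

lemma (in group) not_LERF_path: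
  assumes [simp]: "a \<in> carrier G" "b \<in> carrier G" "c \<in> carrier G" "d \<in> carrier G"
    and rels: "a \<otimes> b = b \<otimes> a" "b \<otimes> c = c \<otimes> b" "c \<otimes> d = d \<otimes> c"
  defines "x \<equiv> inv d \<otimes> (b \<otimes> d)"
  assumes notin: "inv x \<otimes> (c \<otimes> inv b) \<otimes> x \<notin>
      generate G {c \<otimes> inv b, c \<otimes> c \<otimes> inv (x \<otimes> x \<otimes> x), a \<otimes> d}"
  shows "\<not> LERF G"
proof (rule not_LERF[OF _ _ _ _ _ _ _ notin])
  have [simp]: "x \<in> carrier G" by (simp add: x_def)
  have "x \<otimes> c = inv d \<otimes> (b \<otimes> (d \<otimes> c))" by (simp add: x_def m_assoc)
  also have "\<dots> = inv d \<otimes> (d \<otimes> (c \<otimes> (inv d \<otimes> (b \<otimes> d))))"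
  proof -
    have "b \<otimes> (d \<otimes> c) = (b \<otimes> c) \<otimes> d" using rels(3) by (simp add: m_assoc)
    also have "\<dots> = c \<otimes> (b \<otimes> d)" using rels(2) by (simp add: m_assoc)
    also have "\<dots> = (c \<otimes> d) \<otimes> (inv d \<otimes> (b \<otimes> d))" by (simp add: m_assoc)
    also have "\<dots> = d \<otimes> (c \<otimes> (inv d \<otimes> (b \<otimes> d)))" unfolding rels(3) by (simp add: m_assoc)
    finally show ?thesis by simp
  qed
  also have "\<dots> = c \<otimes> x" by (simp add: x_def)
  finally show "x \<otimes> c = c \<otimes> x" .
  have "a \<otimes> d \<otimes> x = (a \<otimes> b) \<otimes> d" by (simp add: x_def m_assoc)
  then show "a \<otimes> d \<otimes> x = b \<otimes> (a \<otimes> d)" using rels(1) by (simp add: m_assoc)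
qed (use rels x_def in simp_all)

section \<open>A permutation representation of the virtual braid groups\<close>

lemma carrier_BijGroup_UNIV: "carrier (BijGroup UNIV) = {f. bij f}"
  by (auto simp: BijGroup_def Bij_def)

lemma mult_BijGroup_UNIV: "bij f \<Longrightarrow> bij g \<Longrightarrow> f \<otimes>\<^bsub>BijGroup UNIV\<^esub> g = f \<circ> g"
  by (auto simp: BijGroup_def Bij_def compose_def)

lemma one_BijGroup_UNIV: "\<one>\<^bsub>BijGroup UNIV\<^esub> = id"
  by (auto simp: BijGroup_def)

section \<open>Permutations of \<int> \<times> \<int> satisfying the relation of BS(2,3)\<close>

fun shift :: "int \<times> int \<Rightarrow> int \<times> int"
  where "shift (k, i) = (k + 1, i)"

fun unshift :: "int \<times> int \<Rightarrow> int \<times> int"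
  where "unshift (k, i) = (k - 1, i)"

text \<open>\<open>shift ^^ m\<close> has the orbits \<open>{k. k mod m = r} \<times> {i}\<close>, numbered by \<open>m * i + r\<close>. The next
  map matches the orbits of \<open>shift ^^ 2\<close> with those of \<open>shift ^^ 3\<close>, so that \<open>shift\<close> and
  \<open>stretch\<close> generate a quotient of \<open>BS(2,3)\<close> that is not residually finite.\<close>

fun stretch :: "int \<times> int \<Rightarrow> int \<times> int"
  where "stretch (k, i) = (3 * (k div 2) + (2 * i + k mod 2) mod 3, (2 * i + k mod 2) div 3)"

fun unstretch :: "int \<times> int \<Rightarrow> int \<times> int"
  where "unstretch (k, i) = (2 * (k div 3) + (3 * i + k mod 3) mod 2, (3 * i + k mod 3) div 2)"

lemma shift_unshift [simp]: "shift (unshift y) = y" "unshift (shift y) = y"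
  by (cases y; simp)+

lemma stretch_unstretch [simp]: "stretch (unstretch y) = y" "unstretch (stretch y) = y"
  by (cases y; simp)+

text \<open>The Baumslag-Solitar relation: adding 2 to \<open>k\<close> preserves the number of its
  orbit and moves one step along it, which is a step of 3 in the matching orbit.\<close>

lemma stretch_shift2: "stretch (shift (shift y)) = shift (shift (shift (stretch y)))"
proof (cases y)
  case (Pair k i)
  have "(k + 2) div 2 = k div 2 + 1" "(k + 2) mod 2 = k mod 2" by simp_all
  then show ?thesis by (simp add: Pair add.assoc)
qed

lemma bij_shift: "bij shift" "bij unshift" "bij stretch" "bij unstretch"
  by (rule o_bij[of unshift] o_bij[of shift] o_bij[of unstretch] o_bij[of stretch];
      simp add: fun_eq_iff)+

text \<open>The image of the pure generator \<open>\<lambda>\<^sub>i\<^sub>j\<close>; the flag selects one of the two factors of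
  \<open>BS(2,3) \<times> BS(2,3)\<close>. Sending \<open>\<lambda>\<^sub>1\<^sub>3\<close> and \<open>\<lambda>\<^sub>3\<^sub>1\<close> to the identity makes all the remaining
  relations commutations.\<close>

definition twist :: "nat \<Rightarrow> nat \<Rightarrow> bool \<Rightarrow> int \<times> int \<Rightarrow> int \<times> int"
  where "twist i j e = (if (i, j) = (1, 2) \<and> e then unshift else if (i, j) = (2, 1) \<and> e then stretch
    else if (i, j) = (2, 3) \<and> \<not> e then shift else if (i, j) = (3, 2) \<and> \<not> e then stretch else id)"

lemma bij_twist: "bij (twist i j e)"
  by (simp add: twist_def bij_shift)

text \<open>For each flag only one unordered pair of labels acts nontrivially. The pairs occurring
  in \<open>twist_commute\<close> and \<open>twist_braid\<close> are different, so at most one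
  factor there is not the identity.\<close>

lemma twist_eq_id: "{i, j} \<noteq> (if e then {1, 2} else {2, 3}) \<Longrightarrow> twist i j e = id"
  by (auto simp: twist_def)

lemma twist_commute:
  assumes "distinct [i, j, k, l]"
  shows "twist i j e (twist k l e y) = twist k l e (twist i j e y)"
proof -
  have "{i, j} \<noteq> {k, l}" using assms by (auto simp: doubleton_eq_iff)
  then have "twist i j e = id \<or> twist k l e = id" by (metis twist_eq_id)
  then show ?thesis by auto
qed

lemma twist_braid:
  assumes "distinct [i, j, k]"
  shows "twist j k e (twist i k e (twist i j e y)) = twist i j e (twist i k e (twist j k e y))"
proof -
  have "{i, j} \<noteq> {i, k}" "{i, j} \<noteq> {j, k}" "{i, k} \<noteq> {j, k}"
    using assms by (auto simp: doubleton_eq_iff)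
  then have "twist i j e = id \<and> twist i k e = id \<or> twist i j e = id \<and> twist j k e = id
      \<or> twist i k e = id \<and> twist j k e = id" by (metis twist_eq_id)
  then show ?thesis by auto
qed

text \<open>In a state \<open>(p, e, y)\<close>, \<open>p k\<close> is the label of the strand in position \<open>k\<close>. A pure element
  fixes \<open>p\<close> and thus acts on the last component alone, which gives a map defined on the pure group
  without a presentation of it. The condition \<open>inj p\<close> provides the distinct labels required
  by \<open>twist_braid\<close> and \<open>twist_commute\<close>.\<close>

fun strand_act ::
    "braid_gen \<Rightarrow> (nat \<Rightarrow> nat) \<times> bool \<times> int \<times> int \<Rightarrow> (nat \<Rightarrow> nat) \<times> bool \<times> int \<times> int"
  where "strand_act (Vir i) (p, e, y) = (p \<circ> transpose i (Suc i), e, y)"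
  | "strand_act (Sig i) (p, e, y) =
      (p \<circ> transpose i (Suc i), e, if inj p then twist (p i) (p (Suc i)) e y else y)"
  | "strand_act (Tau i) (p, e, y) =
      (p \<circ> transpose i (Suc i), e, if inj p then twist (p i) (p (Suc i)) e y else y)"

lemma inj_comp_transpose: "inj (p \<circ> transpose i j) \<longleftrightarrow> inj p"
proof
  assume "inj (p \<circ> transpose i j)"
  then have "inj (p \<circ> transpose i j \<circ> transpose i j)" by (rule inj_compose) simp
  then show "inj p" by (simp add: comp_assoc)
qed (simp add: inj_compose)

lemma bij_strand_act: "bij (strand_act x)"
proof -
  have Vir: "bij (strand_act (Vir i))" for i
    by (rule o_bij[of "strand_act (Vir i)"]) (simp_all add: fun_eq_iff)
  \<comment> \<open>A crossing \<open>Sig i\<close> or \<open>Tau i\<close> is \<open>Vir i\<close>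
    applied after \<open>f i\<close>, and \<open>f i\<close> permutes each fibre over fixed
    \<open>p\<close> and \<open>e\<close>.\<close>
  define f where "f i = (\<lambda>(p :: nat \<Rightarrow> nat, e, y). (p, e, if inj p then twist (p i) (p (Suc i)) e y else y))"
    for i
  have "bij (f i)" for i
  proof (rule bijI)
    show "inj (f i)" 
      by (rule injI) (auto simp: f_def inj_eq[OF bij_is_inj[OF bij_twist]] simp del: split_paired_All
        split: if_splits prod.splits)
    show "surj (f i)"
    proof (rule surjI)
      fix s :: "(nat \<Rightarrow> nat) \<times> bool \<times> int \<times> int"
      obtain p e y where s: "s = (p, e, y)" by (metis prod_cases3)
      show "f i ((\<lambda>(p, e, y). (p, e, if inj p then inv' (twist (p i) (p (Suc i)) e) y else y)) s) = s"
        using surj_f_inv_f[OF bij_is_surj[OF bij_twist]] by (simp add: f_def s)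
    qed
  qed
  moreover have "strand_act (Sig i) = strand_act (Vir i) \<circ> f i" "strand_act (Tau i) = strand_act (Vir i) \<circ> f i" for i
    by (auto simp: fun_eq_iff f_def)
  ultimately show ?thesis using Vir by (cases x) (simp_all add: bij_comp)
qed

lemma bij_word_value_strand_act: "bij (word_value (BijGroup UNIV) strand_act w)"
proof -
  have "w \<in> words UNIV" by (simp add: words_def)
  then have "word_value (BijGroup UNIV) strand_act w \<in> carrier (BijGroup UNIV)"
    by (intro group.word_value_closed[OF group_BijGroup, of _ UNIV])
      (auto simp: carrier_BijGroup_UNIV bij_strand_act)
  then show ?thesis by (simp add: carrier_BijGroup_UNIV)
qed

lemma word_value_strand_act_Nil: "word_value (BijGroup UNIV) strand_act [] = id"
  by (simp add: word_value_def one_BijGroup_UNIV)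

lemma word_value_strand_act_Cons:
  "word_value (BijGroup UNIV) strand_act (pos (x # xs)) =
    strand_act x \<circ> word_value (BijGroup UNIV) strand_act (pos xs)"
proof -
  have "word_value (BijGroup UNIV) strand_act (pos (x # xs)) =
      strand_act x \<otimes>\<^bsub>BijGroup UNIV\<^esub> word_value (BijGroup UNIV) strand_act (pos xs)"
    by (simp only: word_value_def pos_def list.map foldr.simps comp_apply case_prod_conv if_True)
  then show ?thesis by (simp only: mult_BijGroup_UNIV[OF bij_strand_act bij_word_value_strand_act])
qed

lemma word_value_strand_act_pos_Nil: "word_value (BijGroup UNIV) strand_act (pos []) = id"
  unfolding pos_def list.map by (rule word_value_strand_act_Nil)

lemmas word_value_strand_act =
  word_value_strand_act_Nil word_value_strand_act_Cons word_value_strand_act_pos_Nil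

section \<open>The defining relations under the strand action\<close>

lemma comp_transpose_braid:
  assumes "\<bar>int i - int j\<bar> = 1"
  shows "p \<circ> transpose i (Suc i) \<circ> transpose j (Suc j) \<circ> transpose i (Suc i) =
    p \<circ> transpose j (Suc j) \<circ> transpose i (Suc i) \<circ> transpose j (Suc j)"
  using transpose_braid[OF assms] by (simp add: comp_assoc)

lemma comp_transpose_far:
  assumes "\<bar>int i - int j\<bar> \<ge> 2"
  shows "p \<circ> transpose i (Suc i) \<circ> transpose j (Suc j) = p \<circ> transpose j (Suc j) \<circ> transpose i (Suc i)"
  using transpose_far[OF assms] by (simp add: comp_assoc)

lemma state_eqI:
  fixes f g :: "(nat \<Rightarrow> nat) \<times> bool \<times> int \<times> int \<Rightarrow> 'a"
  shows "(\<And>p e y. f (p, e, y) = g (p, e, y)) \<Longrightarrow> f = g"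
  by (rule ext) (metis prod_cases3)

text \<open>Letting \<open>Tau\<close> act like \<open>Sig\<close> turns every relation with
  \<open>Tau\<close> into a relation between \<open>Sig\<close> and \<open>Vir\<close> or into a
  trivial identity.\<close>

lemma strand_act_Tau: "strand_act (Tau i) = strand_act (Sig i)"
  by (rule state_eqI) simp

lemma strand_act_braid:
  assumes ij: "\<bar>int i - int j\<bar> = 1"
  shows "strand_act (Sig i) \<circ> (strand_act (Sig j) \<circ> strand_act (Sig i)) =
    strand_act (Sig j) \<circ> (strand_act (Sig i) \<circ> strand_act (Sig j))"
proof -
  \<comment> \<open>Both sides let the three pairs of labels among \<open>p i\<close>,
    \<open>p (Suc i)\<close>, \<open>p (Suc (Suc i))\<close> cross, in opposite orders, which is
    \<open>twist_braid\<close>. By symmetry in \<open>i\<close> and \<open>j\<close>, the case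
    \<open>j = Suc i\<close> suffices.\<close>
  have *: "strand_act (Sig i) \<circ> (strand_act (Sig (Suc i)) \<circ> strand_act (Sig i)) =
      strand_act (Sig (Suc i)) \<circ> (strand_act (Sig i) \<circ> strand_act (Sig (Suc i)))" for i
  proof (rule state_eqI)
    fix p :: "nat \<Rightarrow> nat" and e and y :: "int \<times> int"
    have "inj p \<Longrightarrow> distinct [p i, p (Suc i), p (Suc (Suc i))]" by (simp add: inj_eq)
    then show "(strand_act (Sig i) \<circ> (strand_act (Sig (Suc i)) \<circ> strand_act (Sig i))) (p, e, y) =
      (strand_act (Sig (Suc i)) \<circ> (strand_act (Sig i) \<circ> strand_act (Sig (Suc i)))) (p, e, y)"
      using comp_transpose_braid[of i "Suc i" p] twist_braid[of "p i" "p (Suc i)" "p (Suc (Suc i))" e y]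
      by (simp add: inj_comp_transpose transpose_def del: distinct.simps)
  qed
  have "j = Suc i \<or> i = Suc j" using ij by auto
  then show ?thesis using *[of i] *[of j] by auto
qed

lemma strand_act_Vir_braid:
  assumes ij: "\<bar>int i - int j\<bar> = 1"
  shows "strand_act (Vir i) \<circ> (strand_act (Vir j) \<circ> strand_act (Vir i)) =
    strand_act (Vir j) \<circ> (strand_act (Vir i) \<circ> strand_act (Vir j))"
  by (rule state_eqI) (simp add: comp_transpose_braid[OF assms])

lemma strand_act_mixed:
  assumes ij: "\<bar>int i - int j\<bar> = 1"
  shows "strand_act (Vir i) \<circ> (strand_act (Sig j) \<circ> strand_act (Vir i)) =
    strand_act (Vir j) \<circ> (strand_act (Sig i) \<circ> strand_act (Vir j))"
proof (rule state_eqI)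
  fix p :: "nat \<Rightarrow> nat" and e and y :: "int \<times> int"
  have "j = Suc i \<or> i = Suc j" using ij by auto
  \<comment> \<open>The crossing \<open>Sig\<close> meets the same two labels in the same order on
    both sides.\<close>
  then have "transpose i (Suc i) j = transpose j (Suc j) i"
    "transpose i (Suc i) (Suc j) = transpose j (Suc j) (Suc i)"
    by (auto simp: transpose_def)
  then show "(strand_act (Vir i) \<circ> (strand_act (Sig j) \<circ> strand_act (Vir i))) (p, e, y) =
    (strand_act (Vir j) \<circ> (strand_act (Sig i) \<circ> strand_act (Vir j))) (p, e, y)"
    by (simp add: inj_comp_transpose comp_transpose_braid[OF ij])
qed

lemma strand_act_mixed':
  "strand_act (Vir i) \<circ> (strand_act (Vir (Suc i)) \<circ> strand_act (Sig i)) =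
    strand_act (Sig (Suc i)) \<circ> (strand_act (Vir i) \<circ> strand_act (Vir (Suc i)))"
  using comp_transpose_braid[of i "Suc i"]
  by (intro state_eqI) (simp add: inj_comp_transpose transpose_def)

lemma strand_act_far:
  assumes ij: "\<bar>int i - int j\<bar> \<ge> 2" and gh: "g \<in> {Sig, Tau, Vir}" "h \<in> {Sig, Tau, Vir}"
  shows "strand_act (g i) \<circ> strand_act (h j) = strand_act (h j) \<circ> strand_act (g i)"
proof (rule state_eqI)
  fix p :: "nat \<Rightarrow> nat" and e and y :: "int \<times> int"
  have neq: "i \<noteq> j" "Suc i \<noteq> j" "i \<noteq> Suc j" using ij by auto
  then have tr: "transpose i (Suc i) j = j" "transpose i (Suc i) (Suc j) = Suc j"
    "transpose j (Suc j) i = i" "transpose j (Suc j) (Suc i) = Suc i"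
    by (auto simp: transpose_def)
  have tw: "twist (p i) (p (Suc i)) e (twist (p j) (p (Suc j)) e y) =
      twist (p j) (p (Suc j)) e (twist (p i) (p (Suc i)) e y)" if "inj p"
    using neq that by (intro twist_commute) (auto simp: inj_eq)
  show "(strand_act (g i) \<circ> strand_act (h j)) (p, e, y) = (strand_act (h j) \<circ> strand_act (g i)) (p, e, y)"
    using gh comp_transpose_far[OF ij, of p] tw
    by (elim insertE emptyE) (simp_all add: inj_comp_transpose tr)
qed

lemma strand_act_Vir_Vir: "strand_act (Vir i) \<circ> strand_act (Vir i) = id"
  by (rule state_eqI) (simp add: comp_assoc)

lemma VSG_rels_strand_act:
  assumes "(l, r) \<in> VSG_rels n"
  shows "word_value (BijGroup UNIV) strand_act l = word_value (BijGroup UNIV) strand_act r"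
  using assms unfolding VSG_rels_def
  by (elim UnE CollectE exE conjE)
    (simp_all only: prod.inject word_value_strand_act comp_id strand_act_Tau strand_act_braid strand_act_Vir_braid strand_act_mixed
      strand_act_Vir_Vir strand_act_far)

lemma VB_rels_strand_act:
  assumes "(l, r) \<in> VB_rels n"
  shows "word_value (BijGroup UNIV) strand_act l = word_value (BijGroup UNIV) strand_act r"
proof -
  have "strand_act (Sig i) \<circ> (strand_act (Sig (i + 1)) \<circ> strand_act (Sig i)) =
      strand_act (Sig (i + 1)) \<circ> (strand_act (Sig i) \<circ> strand_act (Sig (i + 1)))"
    "strand_act (Vir i) \<circ> (strand_act (Vir (i + 1)) \<circ> strand_act (Vir i)) =
      strand_act (Vir (i + 1)) \<circ> (strand_act (Vir i) \<circ> strand_act (Vir (i + 1)))"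
    "strand_act (Vir i) \<circ> (strand_act (Vir (i + 1)) \<circ> strand_act (Sig i)) =
      strand_act (Sig (i + 1)) \<circ> (strand_act (Vir i) \<circ> strand_act (Vir (i + 1)))" for i
    using strand_act_braid[of i "Suc i"] strand_act_Vir_braid[of i "Suc i"] strand_act_mixed'[of i]
    by simp_all
  moreover have "strand_act (Sig i) \<circ> strand_act (Sig j) = strand_act (Sig j) \<circ> strand_act (Sig i)"
    "strand_act (Vir i) \<circ> strand_act (Vir j) = strand_act (Vir j) \<circ> strand_act (Vir i)"
    "strand_act (Sig i) \<circ> strand_act (Vir j) = strand_act (Vir j) \<circ> strand_act (Sig i)"
    if "\<bar>int i - int j\<bar> \<ge> 2" for i j
    using strand_act_far[OF that] by simp_all
  ultimately show ?thesis
    using assms unfolding VB_rels_def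
    by (elim UnE CollectE exE conjE)
      (simp_all only: prod.inject word_value_strand_act comp_id strand_act_Vir_Vir)
qed

section \<open>The obstruction in the pure group, common to \<open>VB n\<close> and
  \<open>VSG n\<close>\<close>

locale virtual_braid_quotient = group_hom G "sym_group n" perm for G (structure) and n and perm +
  fixes \<rho> and s1 s2 v1 v2
  assumes closed [simp]: "s1 \<in> carrier G" "s2 \<in> carrier G" "v1 \<in> carrier G" "v2 \<in> carrier G"
    and vv: "v1 \<otimes> v1 = \<one>" "v2 \<otimes> v2 = \<one>"
    and vvv: "v2 \<otimes> (v1 \<otimes> v2) = v1 \<otimes> (v2 \<otimes> v1)"
    and sss: "s1 \<otimes> (s2 \<otimes> s1) = s2 \<otimes> (s1 \<otimes> s2)"
    and svv: "s2 \<otimes> (v1 \<otimes> v2) = v1 \<otimes> (v2 \<otimes> s1)"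
    and perm: "perm s1 = transpose 1 2" "perm s2 = transpose 2 3"
      "perm v1 = transpose 1 2" "perm v2 = transpose 2 3"
    and rho_hom: "\<rho> \<in> hom G (BijGroup UNIV)"
    and rho: "\<rho> s1 = strand_act (Sig 1)" "\<rho> s2 = strand_act (Sig 2)"
      "\<rho> v1 = strand_act (Vir 1)" "\<rho> v2 = strand_act (Vir 2)"
begin

abbreviation pure where "pure \<equiv> G\<lparr>carrier := kernel G (sym_group n) perm\<rparr>"

lemma group_pure: "group pure"
  using subgroup.subgroup_is_group[OF subgroup_kernel G.group_axioms] .

lemma rho_mult: "z \<in> carrier G \<Longrightarrow> w \<in> carrier G \<Longrightarrow> \<rho> (z \<otimes> w) = \<rho> z \<circ> \<rho> w"
  and bij_rho: "z \<in> carrier G \<Longrightarrow> bij (\<rho> z)"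
proof -
  show bij: "bij (\<rho> z)" if "z \<in> carrier G" for z
    using hom_in_carrier[OF rho_hom that] by (simp add: carrier_BijGroup_UNIV)
  show "\<rho> (z \<otimes> w) = \<rho> z \<circ> \<rho> w" if "z \<in> carrier G" "w \<in> carrier G"
    using Group.hom_mult[OF rho_hom that] bij that by (simp add: mult_BijGroup_UNIV)
qed

text \<open>Stands in for a homomorphism from the pure group to pairs of permutations, with
  \<open>f\<close> and \<open>g\<close> the components over the flags \<open>False\<close> and
  \<open>True\<close>. As a relation it has to be established only for the elements in use.\<close>

definition fibre_maps where
  "fibre_maps z f g \<longleftrightarrow> z \<in> carrier pure \<and>
    (\<forall>y. \<rho> z (id, False, y) = (id, False, f y)) \<and> (\<forall>y. \<rho> z (id, True, y) = (id, True, g y))"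

lemma carrier_pure: "z \<in> carrier pure \<Longrightarrow> z \<in> carrier G"
  by (simp add: kernel_def)

lemma fibre_maps_mult:
  assumes "fibre_maps z f g" "fibre_maps w f' g'"
  shows "fibre_maps (z \<otimes>\<^bsub>pure\<^esub> w) (\<lambda>y. f (f' y)) (\<lambda>y. g (g' y))"
proof -
  have "z \<otimes>\<^bsub>pure\<^esub> w \<in> carrier pure"
    using assms monoid.m_closed[OF group.is_monoid[OF group_pure]] unfolding fibre_maps_def by blast
  then show ?thesis
    using assms carrier_pure[of z] carrier_pure[of w] by (simp add: fibre_maps_def rho_mult del: split_paired_All)
qed

lemma fibre_maps_inv:
  assumes z: "fibre_maps z f g" and inv: "\<And>y. f (f' y) = y" "\<And>y. g (g' y) = y"
  shows "fibre_maps (inv\<^bsub>pure\<^esub> z) f' g'"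
proof -
  have zN: "z \<in> carrier pure" using z by (simp add: fibre_maps_def)
  then have N: "inv\<^bsub>pure\<^esub> z \<in> carrier pure" "inv\<^bsub>pure\<^esub> z \<otimes>\<^bsub>pure\<^esub> z = \<one>\<^bsub>pure\<^esub>"
    using group.inv_closed[OF group_pure] group.l_inv[OF group_pure] by blast+
  have one: "\<rho> \<one> = id"
    using Group.hom_one[OF rho_hom G.group_axioms group_BijGroup] by (simp add: one_BijGroup_UNIV)
  have "\<rho> (inv\<^bsub>pure\<^esub> z) \<circ> \<rho> z = id"
    using N zN carrier_pure one by (simp flip: rho_mult)
  then have *: "\<rho> (inv\<^bsub>pure\<^esub> z) (\<rho> z s) = s" for s by (metis comp_apply id_apply)
  have "\<rho> z (id, False, f' y) = (id, False, y)" "\<rho> z (id, True, g' y) = (id, True, y)" for y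
    using z inv by (simp_all add: fibre_maps_def del: split_paired_All)
  then show ?thesis using N * unfolding fibre_maps_def by metis
qed

lemma fibre_maps_unique: "fibre_maps z f g \<Longrightarrow> fibre_maps z f' g' \<Longrightarrow> f = f' \<and> g = g'"
  by (simp add: fibre_maps_def fun_eq_iff)

text \<open>Bounds the nonseparable subgroup from outside: its generators will have equal
  components, so an element with unequal ones is not in it.\<close>

lemma diagonal_subgroup: "subgroup {z. \<exists>h. bij h \<and> fibre_maps z h h} pure" (is "subgroup ?D _")
proof (rule group.subgroupI[OF group_pure])
  show "?D \<subseteq> carrier pure" by (auto simp: fibre_maps_def)
  have "\<one> \<in> carrier pure" by (simp add: kernel_def)
  moreover have "\<rho> \<one> = id"
    using Group.hom_one[OF rho_hom G.group_axioms group_BijGroup] by (simp add: one_BijGroup_UNIV)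
  ultimately have "fibre_maps \<one> id id" by (simp add: fibre_maps_def)
  then show "?D \<noteq> {}" using bij_id by blast
next
  fix z assume "z \<in> ?D"
  then obtain h where "bij h" "fibre_maps z h h" by blast
  then have "bij (inv' h)" "fibre_maps (inv\<^bsub>pure\<^esub> z) (inv' h) (inv' h)"
    using surj_f_inv_f[OF bij_is_surj, of h] bij_imp_bij_inv[of h] fibre_maps_inv[of z h h "inv' h" "inv' h"]
    by simp_all
  then show "inv\<^bsub>pure\<^esub> z \<in> ?D" by blast
next
  fix z w assume "z \<in> ?D" "w \<in> ?D"
  then obtain h k where "bij h" "fibre_maps z h h" "bij k" "fibre_maps w k k" by blast
  then have "bij (h \<circ> k)" "fibre_maps (z \<otimes>\<^bsub>pure\<^esub> w) (h \<circ> k) (h \<circ> k)"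
    using fibre_maps_mult unfolding comp_def[symmetric] by (blast intro: bij_comp)+
  then show "z \<otimes>\<^bsub>pure\<^esub> w \<in> ?D" by blast
qed

lemma not_LERF_pure: "\<not> LERF pure"
proof -
  interpret N: group pure by (rule group_pure)
  define l12 where "l12 = v1 \<otimes> s1"
  define l21 where "l21 = s1 \<otimes> v1"
  define l23 where "l23 = v2 \<otimes> s2"
  define l32 where "l32 = s2 \<otimes> v2"
  define l13 where "l13 = v2 \<otimes> (v1 \<otimes> (s1 \<otimes> v2))"
  note defs = l12_def l21_def l23_def l32_def l13_def
  have mem: "l12 \<in> carrier pure" "l21 \<in> carrier pure" "l23 \<in> carrier pure" "l32 \<in> carrier pure"
    "l13 \<in> carrier pure"
    by (simp_all add: kernel_def defs perm sym_group_mult sym_group_one comp_assoc[symmetric])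
  define a where "a = inv\<^bsub>pure\<^esub> l13 \<otimes>\<^bsub>pure\<^esub> l32"
  define b where "b = l12 \<otimes>\<^bsub>pure\<^esub> l13"
  define c where "c = l23 \<otimes>\<^bsub>pure\<^esub> l13"
  define d where "d = inv\<^bsub>pure\<^esub> l13 \<otimes>\<^bsub>pure\<^esub> l21"
  define x where "x = inv\<^bsub>pure\<^esub> d \<otimes>\<^bsub>pure\<^esub> (b \<otimes>\<^bsub>pure\<^esub> d)"
  let ?g = "inv\<^bsub>pure\<^esub> x \<otimes>\<^bsub>pure\<^esub> (c \<otimes>\<^bsub>pure\<^esub> inv\<^bsub>pure\<^esub> b) \<otimes>\<^bsub>pure\<^esub> x"
  let ?A = "{c \<otimes>\<^bsub>pure\<^esub> inv\<^bsub>pure\<^esub> b, c \<otimes>\<^bsub>pure\<^esub> c \<otimes>\<^bsub>pure\<^esub> inv\<^bsub>pure\<^esub> (x \<otimes>\<^bsub>pure\<^esub> x \<otimes>\<^bsub>pure\<^esub> x), a \<otimes>\<^bsub>pure\<^esub> d}"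
  have rels: "l12 \<otimes>\<^bsub>pure\<^esub> (l13 \<otimes>\<^bsub>pure\<^esub> l23) = l23 \<otimes>\<^bsub>pure\<^esub> (l13 \<otimes>\<^bsub>pure\<^esub> l12)"
    "l13 \<otimes>\<^bsub>pure\<^esub> (l12 \<otimes>\<^bsub>pure\<^esub> l32) = l32 \<otimes>\<^bsub>pure\<^esub> (l12 \<otimes>\<^bsub>pure\<^esub> l13)"
    "l21 \<otimes>\<^bsub>pure\<^esub> (l23 \<otimes>\<^bsub>pure\<^esub> l13) = l13 \<otimes>\<^bsub>pure\<^esub> (l23 \<otimes>\<^bsub>pure\<^esub> l21)"
    using G.virtual_braid_relations[OF closed vv vvv sss svv] by (simp_all add: defs)
  note path = N.path_of_commuting_elements[OF mem rels, folded a_def b_def c_def d_def]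
  have carr: "a \<in> carrier pure" "b \<in> carrier pure" "c \<in> carrier pure" "d \<in> carrier pure"
    unfolding a_def b_def c_def d_def by (intro N.m_closed N.inv_closed mem)+
  \<comment> \<open>The crossing in \<open>l12\<close> meets the labels 1, 2 in this order, that in
    \<open>l21\<close> the labels 2, 1, and likewise for the others; for \<open>l13\<close> they are
    1, 3, where \<open>twist\<close> is trivial.\<close>
  have fl: "fibre_maps l12 id unshift" "fibre_maps l21 id stretch" "fibre_maps l23 shift id"
    "fibre_maps l32 stretch id" "fibre_maps l13 id id"
    using mem
    by (simp_all add: fibre_maps_def defs rho_mult rho twist_def transpose_def
      inj_comp_transpose comp_assoc)
  have fa: "fibre_maps a stretch id" and fb: "fibre_maps b id unshift"
    and fc: "fibre_maps c shift id" and fd: "fibre_maps d id stretch"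
    using fibre_maps_mult[OF fibre_maps_inv[OF fl(5), of id id] fl(4)] fibre_maps_mult[OF fl(1,5)]
      fibre_maps_mult[OF fl(3,5)] fibre_maps_mult[OF fibre_maps_inv[OF fl(5), of id id] fl(2)]
    by (simp_all add: a_def b_def c_def d_def id_def)
  have fb': "fibre_maps (inv\<^bsub>pure\<^esub> b) id shift" by (rule fibre_maps_inv[OF fb]) simp_all
  have fx: "fibre_maps x id (\<lambda>y. unstretch (unshift (stretch y)))"
    using fibre_maps_mult[OF fibre_maps_inv[OF fd, of id unstretch] fibre_maps_mult[OF fb fd]]
    by (simp add: x_def id_def)
  have fx': "fibre_maps (inv\<^bsub>pure\<^esub> x) id (\<lambda>y. unstretch (shift (stretch y)))"
    by (rule fibre_maps_inv[OF fx]) simp_all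
  have fcb: "fibre_maps (c \<otimes>\<^bsub>pure\<^esub> inv\<^bsub>pure\<^esub> b) shift shift"
    using fibre_maps_mult[OF fc fb'] by (simp add: id_def)
  \<comment> \<open>Over the flag \<open>True\<close>, the inverse cube of \<open>x\<close> is the
    cube of \<open>shift\<close> conjugated by \<open>stretch\<close>, which is the square of
    \<open>shift\<close>.\<close>
  have fxxx: "fibre_maps (inv\<^bsub>pure\<^esub> (x \<otimes>\<^bsub>pure\<^esub> x \<otimes>\<^bsub>pure\<^esub> x)) id (\<lambda>y. shift (shift y))"
    by (rule fibre_maps_inv[OF fibre_maps_mult[OF fibre_maps_mult[OF fx fx] fx]])
      (simp_all add: stretch_shift2)
  have fccx: "fibre_maps (c \<otimes>\<^bsub>pure\<^esub> c \<otimes>\<^bsub>pure\<^esub> inv\<^bsub>pure\<^esub> (x \<otimes>\<^bsub>pure\<^esub> x \<otimes>\<^bsub>pure\<^esub> x))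
      (\<lambda>y. shift (shift y)) (\<lambda>y. shift (shift y))"
    using fibre_maps_mult[OF fibre_maps_mult[OF fc fc] fxxx] by simp
  have fad: "fibre_maps (a \<otimes>\<^bsub>pure\<^esub> d) stretch stretch"
    using fibre_maps_mult[OF fa fd] by simp
  have diag: "z \<in> {z. \<exists>h. bij h \<and> fibre_maps z h h}" if "bij h" "fibre_maps z h h" for z h
    using that by blast
  have "?A \<subseteq> {z. \<exists>h. bij h \<and> fibre_maps z h h}"
    using diag[OF bij_shift(1) fcb] diag[OF _ fccx] diag[OF bij_shift(3) fad]
      bij_comp[OF bij_shift(1) bij_shift(1)] by (simp only: insert_subset empty_subsetI comp_def simp_thms)
  then have A: "generate pure ?A \<subseteq> {z. \<exists>h. bij h \<and> fibre_maps z h h}"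
    by (rule N.generate_subgroup_incl[OF _ diagonal_subgroup])
  have g: "fibre_maps ?g shift
      (\<lambda>y. unstretch (shift (stretch (shift (unstretch (unshift (stretch y)))))))"
    using fibre_maps_mult[OF fibre_maps_mult[OF fx' fcb] fx] by (simp only: id_apply)
  \<comment> \<open>At (2, 0) the left side is (3, 0) and the right side is (0, 2).\<close>
  have neq: "shift (2, 0) \<noteq> unstretch (shift (stretch (shift (unstretch (unshift (stretch (2, 0)))))))"
    by simp
  have "?g \<notin> generate pure ?A"
  proof
    assume "?g \<in> generate pure ?A"
    then obtain h where "fibre_maps ?g h h" using A by blast
    with fibre_maps_unique[OF g] have "shift = h"
      "(\<lambda>y. unstretch (shift (stretch (shift (unstretch (unshift (stretch y))))))) = h" by blast+
    then show False using neq by metis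
  qed
  then show ?thesis unfolding x_def by (rule N.not_LERF_path[OF carr path])
qed

end

section \<open>Actions on double cosets\<close>

lemma int_multiples_closed:
  assumes zero: "(0::int) \<in> D" and diff: "\<And>i j. i \<in> D \<Longrightarrow> j \<in> D \<Longrightarrow> i - j \<in> D" and d: "d \<in> D"
  shows "d * k \<in> D"
proof (induction k rule: int_induct[where k = 0])
  case (step1 i)
  have "d * i - (0 - d) \<in> D" by (rule diff[OF step1(2) diff[OF zero d]])
  then show ?case by (simp add: algebra_simps)
next
  case (step2 i)
  have "d * i - d \<in> D" by (rule diff[OF step2(2) d])
  then show ?case by (simp add: algebra_simps)
qed (use zero in simp)

text \<open>Subgroups of \<int> are closed in the profinite topology: the modulus
  \<open>\<bar>a\<bar> + 1\<close> settles \<open>D = {0}\<close>, and otherwise the absolute value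
  of a nonzero element of \<open>D\<close> serves as modulus.\<close>

lemma int_subgroup_separable:
  assumes zero: "(0::int) \<in> D" and diff: "\<And>i j. i \<in> D \<Longrightarrow> j \<in> D \<Longrightarrow> i - j \<in> D"
    and approx: "\<And>m. m > 0 \<Longrightarrow> \<exists>k. a + m * k \<in> D"
  shows "a \<in> D"
proof (cases "D = {0}")
  case True
  have "\<exists>k. a + (\<bar>a\<bar> + 1) * k \<in> D" by (rule approx) linarith
  then obtain k where "a + (\<bar>a\<bar> + 1) * k = 0" unfolding True by (elim exE singletonE)
  then have "a = (\<bar>a\<bar> + 1) * (- k)" by (simp only: mult_minus_right eq_neg_iff_add_eq_0)
  then have dvd: "\<bar>a\<bar> + 1 dvd a" by (rule dvdI)
  have "a = 0"
  proof (rule ccontr)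
    assume "a \<noteq> 0"
    from dvd_imp_le_int[OF this dvd] show False by linarith
  qed
  then show ?thesis unfolding True by simp
next
  case False
  then obtain d where d: "d \<in> D" "d \<noteq> 0" using zero by blast
  have mult: "e * k \<in> D" if "e \<in> D" for e k by (rule int_multiples_closed[OF zero diff that])
  have abs: "\<bar>d\<bar> \<in> D" using mult[OF d(1), of "sgn d"] by (simp only: abs_sgn)
  have "\<exists>k. a + \<bar>d\<bar> * k \<in> D" using d(2) by (intro approx) simp
  then obtain k where "a + \<bar>d\<bar> * k \<in> D" by blast
  from diff[OF this mult[OF abs, of k]] show ?thesis by simp
qed

text \<open>Two uses of the one-dimensional case: for the projection \<open>E\<close> of
  \<open>L\<close> to the second coordinate, then for the elements of \<open>L\<close> whose second
  coordinate is 0.\<close>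

lemma int2_subgroup_separable:
  assumes zero: "(0::int, 0::int) \<in> L"
    and diff: "\<And>i j i' j'. (i, j) \<in> L \<Longrightarrow> (i', j') \<in> L \<Longrightarrow> (i - i', j - j') \<in> L"
    and approx: "\<And>m. m > 0 \<Longrightarrow> \<exists>i j. (a + m * i, b + m * j) \<in> L"
  shows "(a, b) \<in> L"
proof -
  have mult: "(i * k, j * k) \<in> L" if "(i, j) \<in> L" for i j k
  proof -
    have "1 * k \<in> {k. (i * k, j * k) \<in> L}"
      by (rule int_multiples_closed) (use zero diff that in \<open>auto simp: right_diff_distrib\<close>)
    then show ?thesis by simp
  qed
  define E where "E = {j. \<exists>i. (i, j) \<in> L}"
  have "b \<in> E"
  proof (rule int_subgroup_separable)
    show "0 \<in> E" using zero unfolding E_def by blast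
    show "j - j' \<in> E" if "j \<in> E" "j' \<in> E" for j j'
      using that diff unfolding E_def by blast
    show "\<exists>k. b + m * k \<in> E" if "m > 0" for m using approx[OF that] unfolding E_def by blast
  qed
  then obtain a0 where a0: "(a0, b) \<in> L" unfolding E_def by blast
  obtain e f where e: "(f, e) \<in> L" "e > 0 \<or> E = {0}"
  proof (cases "E = {0}")
    case False
    then obtain f e where fe: "(f, e) \<in> L" "e \<noteq> 0" using zero unfolding E_def by blast
    have "(f * sgn e, \<bar>e\<bar>) \<in> L" using mult[OF fe(1), of "sgn e"] by (simp only: abs_sgn)
    then show thesis using that fe(2) by (meson zero_less_abs_iff)
  qed (use zero that in blast)
  \<comment> \<open>With modulus \<open>m * M\<close> the second coordinate of the error is a
    multiple of \<open>e\<close>. Subtracting \<open>m * j\<close> times \<open>(f, e)\<close>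
    removes it and changes the first coordinate by a multiple of \<open>m\<close>. If
    \<open>E = {0}\<close>, the second coordinate vanishes by itself and \<open>M = 1\<close> will
    do.\<close>
  define M where "M = (if e > 0 then e else 1)"
  have "a - a0 \<in> {i. (i, 0) \<in> L}"
  proof (rule int_subgroup_separable)
    fix m :: int assume "m > 0"
    then have "m * M > 0" by (simp add: M_def)
    then obtain i j where "(a + m * M * i, b + m * M * j) \<in> L" using approx by blast
    from diff[OF this a0] have ij: "(a - a0 + m * M * i, m * M * j) \<in> L" by (simp add: algebra_simps)
    show "\<exists>k. a - a0 + m * k \<in> {i. (i, 0) \<in> L}"
    proof (cases "e > 0")
      case True
      have "(a - a0 + m * M * i - f * (m * j), m * M * j - e * (m * j)) \<in> L"
        using diff[OF ij mult[OF e(1)]] .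
      then have "(a - a0 + m * (M * i - f * j), 0) \<in> L" using True by (simp add: M_def algebra_simps)
      then show ?thesis by blast
    next
      case False
      then have "m * M * j \<in> {0}" using e(2) ij unfolding E_def by blast
      then have z: "m * M * j = 0" by (rule singletonD)
      have "(a - a0 + m * (M * i), 0) \<in> L" using ij z by (simp only: mult.assoc)
      then show ?thesis by blast
    qed
  next
    show "0 \<in> {i. (i, 0) \<in> L}" using zero by simp
    show "i - j \<in> {i. (i, 0) \<in> L}" if "i \<in> {i. (i, 0) \<in> L}" "j \<in> {i. (i, 0) \<in> L}" for i j
      using diff[of i 0 j 0] that by simp
  qed
  then have "(a - a0, 0) \<in> L" by simp
  from diff[OF this diff[OF zero a0]] show ?thesis by simp
qed

section \<open>Left cosets of a subgroup under two commuting elements\<close>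

locale commuting_pair = group G for G (structure) +
  fixes s t H
  assumes closed [simp]: "s \<in> carrier G" "t \<in> carrier G"
    and commute: "s \<otimes> t = t \<otimes> s"
    and H: "subgroup H G"
begin

definition P :: "int \<Rightarrow> int \<Rightarrow> 'a" where "P i j = s [^] i \<otimes> t [^] j"

lemma P_closed [simp]: "P i j \<in> carrier G" by (simp add: P_def)

lemma P_add: "P i j \<otimes> P k l = P (i + k) (j + l)"
proof -
  have "P i j \<otimes> P k l = s [^] i \<otimes> ((t [^] j \<otimes> s [^] k) \<otimes> t [^] l)" by (simp add: P_def m_assoc)
  also have "t [^] j \<otimes> s [^] k = s [^] k \<otimes> t [^] j" using commute by (intro commute_pow) simp_all
  also have "s [^] i \<otimes> ((s [^] k \<otimes> t [^] j) \<otimes> t [^] l) = (s [^] i \<otimes> s [^] k) \<otimes> (t [^] j \<otimes> t [^] l)"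
    by (simp add: m_assoc)
  finally show ?thesis by (simp add: P_def int_pow_mult)
qed

lemma P_add_left: "w \<in> carrier G \<Longrightarrow> P i j \<otimes> (P k l \<otimes> w) = P (i + k) (j + l) \<otimes> w"
  by (simp flip: P_add m_assoc)

lemma P_zero [simp]: "P 0 0 = \<one>" by (simp add: P_def)

lemma P_inv: "inv (P i j) = P (- i) (- j)"
  by (rule inv_equality) (simp_all add: P_add)

lemma P_generators: "P 1 0 = s" "P 0 1 = t" by (simp_all add: P_def)

text \<open>If every modulus failed, \<open>(- a, - b)\<close> would be congruent modulo each
  \<open>m\<close> to an element of the stabilizer \<open>L\<close> of the left coset of
  \<open>x\<close>, hence lie in \<open>L\<close> by separability. Then \<open>P a b\<close> would
  both fix that coset and carry it to the coset of \<open>y\<close>, against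
  \<open>notin\<close>.\<close>

lemma exists_separating_modulus_pair:
  assumes x: "x \<in> carrier G" and y: "y \<in> carrier G" and notin: "inv y \<otimes> x \<notin> H"
  shows "\<exists>m>0. \<forall>i j. inv y \<otimes> (P (m * i) (m * j) \<otimes> x) \<notin> H"
proof (rule ccontr)
  note [simp] = x y
  note Hm = subgroup.m_closed[OF H] and Hi = subgroup.m_inv_closed[OF H]
  assume "\<not> ?thesis"
  then have approx: "\<exists>i j. inv y \<otimes> (P (m * i) (m * j) \<otimes> x) \<in> H" if "m > 0" for m using that by blast
  obtain a b where ab: "inv y \<otimes> (P a b \<otimes> x) \<in> H" using approx[of 1] by auto
  define L where "L = {(i, j). inv x \<otimes> (P i j \<otimes> x) \<in> H}"
  have "(- a, - b) \<in> L"
  proof (rule int2_subgroup_separable)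
    show "(0, 0) \<in> L" using subgroup.one_closed[OF H] by (simp add: L_def)
  next
    fix i j i' j' assume ij: "(i, j) \<in> L" "(i', j') \<in> L"
    have "(inv x \<otimes> (P i j \<otimes> x)) \<otimes> inv (inv x \<otimes> (P i' j' \<otimes> x)) \<in> H"
      using ij unfolding L_def by (blast intro: Hm Hi)
    moreover have "(inv x \<otimes> (P i j \<otimes> x)) \<otimes> inv (inv x \<otimes> (P i' j' \<otimes> x)) = inv x \<otimes> (P (i - i') (j - j') \<otimes> x)"
      by (simp add: inv_mult_group m_assoc P_inv P_add_left)
    ultimately show "(i - i', j - j') \<in> L" by (simp add: L_def)
  next
    fix m :: int assume "m > 0"
    then obtain i j where ij: "inv y \<otimes> (P (m * i) (m * j) \<otimes> x) \<in> H" using approx by blast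
    have "inv (inv y \<otimes> (P a b \<otimes> x)) \<otimes> (inv y \<otimes> (P (m * i) (m * j) \<otimes> x)) \<in> H"
      using ij ab by (blast intro: Hm Hi)
    moreover have "inv (inv y \<otimes> (P a b \<otimes> x)) \<otimes> (inv y \<otimes> (P (m * i) (m * j) \<otimes> x))
        = inv x \<otimes> (P (- a + m * i) (- b + m * j) \<otimes> x)"
      by (simp add: inv_mult_group m_assoc P_inv P_add_left)
    ultimately show "\<exists>i j. (- a + m * i, - b + m * j) \<in> L" by (auto simp: L_def)
  qed
  then have "(inv y \<otimes> (P a b \<otimes> x)) \<otimes> (inv x \<otimes> (P (- a) (- b) \<otimes> x)) \<in> H"
    using ab unfolding L_def by (blast intro: Hm)
  moreover have "(inv y \<otimes> (P a b \<otimes> x)) \<otimes> (inv x \<otimes> (P (- a) (- b) \<otimes> x)) = inv y \<otimes> x"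
    by (simp add: m_assoc P_add_left)
  ultimately show False using notin by simp
qed

text \<open>Multiples of a separating modulus still separate, so the product over the finitely many
  pairs works.\<close>

lemma exists_separating_modulus:
  assumes F: "finite F" "F \<subseteq> carrier G"
  shows "\<exists>m>0. \<forall>x\<in>F. \<forall>y\<in>F. \<forall>i j. inv y \<otimes> (P (m * i) (m * j) \<otimes> x) \<in> H \<longrightarrow> inv y \<otimes> x \<in> H"
proof -
  define B where "B = {(x, y) \<in> F \<times> F. inv y \<otimes> x \<notin> H}"
  have B: "finite B" using F by (auto simp: B_def intro: finite_subset[of _ "F \<times> F"])
  have "\<exists>m>0. \<forall>i j. inv (snd p) \<otimes> (P (m * i) (m * j) \<otimes> fst p) \<notin> H" if "p \<in> B" for p
    using exists_separating_modulus_pair[of "fst p" "snd p"] that F(2) unfolding B_def by fastforce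
  then obtain f where f: "\<And>p. p \<in> B \<Longrightarrow> f p > 0"
    "\<And>p i j. p \<in> B \<Longrightarrow> inv (snd p) \<otimes> (P (f p * i) (f p * j) \<otimes> fst p) \<notin> H" by metis
  show ?thesis
  proof (intro exI[of _ "\<Prod>p\<in>B. f p"] conjI ballI allI impI)
    show "(\<Prod>p\<in>B. f p) > 0" using f(1) by (simp add: prod_pos)
    fix x y i j
    assume xy: "x \<in> F" "y \<in> F" and mem: "inv y \<otimes> (P ((\<Prod>p\<in>B. f p) * i) ((\<Prod>p\<in>B. f p) * j) \<otimes> x) \<in> H"
    show "inv y \<otimes> x \<in> H"
    proof (rule ccontr)
      assume "inv y \<otimes> x \<notin> H"
      then have p: "(x, y) \<in> B" using xy by (simp add: B_def)
      then have "f (x, y) dvd (\<Prod>p\<in>B. f p)" by (rule dvd_prodI[OF B])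
      then obtain k where "(\<Prod>p\<in>B. f p) = f (x, y) * k" by blast
      then show False using mem f(2)[OF p, of "k * i" "k * j"] by (simp add: mult.assoc)
    qed
  qed
qed

end

section \<open>Finite quotients of the orbits of left cosets\<close>

context commuting_pair
begin

text \<open>\<open>dc m w\<close> is the double coset \<open>M w H\<close> where \<open>M\<close> is generated by the \<open>m\<close>-th powers of \<open>s\<close>
  and \<open>t\<close>.\<close>

definition dc_rel :: "int \<Rightarrow> ('a \<times> 'a) set" where
  "dc_rel m = {(w, z). w \<in> carrier G \<and> z \<in> carrier G \<and>
    (\<exists>i j. inv w \<otimes> (P (m * i) (m * j) \<otimes> z) \<in> H)}"

definition dc :: "int \<Rightarrow> 'a \<Rightarrow> 'a set" where "dc m w = dc_rel m `` {w}"

lemma dc_relI: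
  "inv w \<otimes> (P (m * i) (m * j) \<otimes> z) \<in> H \<Longrightarrow> w \<in> carrier G \<Longrightarrow> z \<in> carrier G \<Longrightarrow> (w, z) \<in> dc_rel m"
  unfolding dc_rel_def by blast

lemma equiv_dc_rel: "equiv (carrier G) (dc_rel m)"
proof (rule equivI)
  show "refl_on (carrier G) (dc_rel m)"
  proof (rule refl_onI)
    fix x assume "x \<in> carrier G"
    moreover from this have "inv x \<otimes> (P (m * 0) (m * 0) \<otimes> x) \<in> H"
      using subgroup.one_closed[OF H] by simp
    ultimately show "(x, x) \<in> dc_rel m" unfolding dc_rel_def by blast
  qed
  show "dc_rel m \<subseteq> carrier G \<times> carrier G" by (auto simp: dc_rel_def)
  show "sym (dc_rel m)"
  proof (rule symI)
    fix w z assume "(w, z) \<in> dc_rel m"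
    then obtain i j where wz: "w \<in> carrier G" "z \<in> carrier G" "inv w \<otimes> (P (m * i) (m * j) \<otimes> z) \<in> H"
      unfolding dc_rel_def by blast
    have "inv (inv w \<otimes> (P (m * i) (m * j) \<otimes> z)) = inv z \<otimes> (P (m * (- i)) (m * (- j)) \<otimes> w)"
      using wz(1,2) by (simp add: inv_mult_group m_assoc P_inv)
    then have "inv z \<otimes> (P (m * (- i)) (m * (- j)) \<otimes> w) \<in> H"
      using subgroup.m_inv_closed[OF H wz(3)] by simp
    then show "(z, w) \<in> dc_rel m" using wz(1,2) unfolding dc_rel_def by blast
  qed
  show "trans (dc_rel m)"
  proof (rule transI)
    fix w z u assume "(w, z) \<in> dc_rel m" "(z, u) \<in> dc_rel m"
    then obtain i j k l where wz: "w \<in> carrier G" "z \<in> carrier G" "u \<in> carrier G"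
      "inv w \<otimes> (P (m * i) (m * j) \<otimes> z) \<in> H" "inv z \<otimes> (P (m * k) (m * l) \<otimes> u) \<in> H"
      unfolding dc_rel_def by blast
    have "(inv w \<otimes> (P (m * i) (m * j) \<otimes> z)) \<otimes> (inv z \<otimes> (P (m * k) (m * l) \<otimes> u)) =
        inv w \<otimes> (P (m * (i + k)) (m * (j + l)) \<otimes> u)"
      using wz(1-3) by (simp add: m_assoc P_add_left distrib_left)
    then have "inv w \<otimes> (P (m * (i + k)) (m * (j + l)) \<otimes> u) \<in> H"
      using subgroup.m_closed[OF H wz(4,5)] by simp
    then show "(w, u) \<in> dc_rel m" using wz(1,3) unfolding dc_rel_def by blast
  qed
qed

lemma dc_eq_iff: "w \<in> carrier G \<Longrightarrow> z \<in> carrier G \<Longrightarrow> dc m w = dc m z \<longleftrightarrow> (w, z) \<in> dc_rel m"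
  unfolding dc_def by (rule eq_equiv_class_iff[OF equiv_dc_rel])

lemma dc_mult_P:
  assumes "w \<in> carrier G"
  shows "dc m (P (m * i) (m * j) \<otimes> w) = dc m w"
proof -
  have "inv (P (m * i) (m * j) \<otimes> w) \<otimes> (P (m * i) (m * j) \<otimes> w) = \<one>"
    using assms by (intro l_inv) simp
  then have "(P (m * i) (m * j) \<otimes> w, w) \<in> dc_rel m"
    using assms subgroup.one_closed[OF H] by (intro dc_relI[of _ m i j]) simp_all
  then show ?thesis using assms by (simp add: dc_eq_iff)
qed

lemma dc_mult_H:
  assumes w: "w \<in> carrier G" and z: "z \<in> carrier G" and wz: "inv w \<otimes> z \<in> H"
  shows "dc m w = dc m z"
proof -
  have "inv w \<otimes> (P (m * 0) (m * 0) \<otimes> z) \<in> H" using z wz by simp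
  then have "(w, z) \<in> dc_rel m" using w z unfolding dc_rel_def by blast
  then show ?thesis using w z by (simp add: dc_eq_iff)
qed

text \<open>Left translation by \<open>P a b\<close> permutes the double cosets because
  \<open>P a b\<close> commutes with the powers of \<open>s\<close> and \<open>t\<close>. The
  reverse inclusion is \<open>sub\<close> for the inverse translation.\<close>

lemma translate_dc:
  assumes w: "w \<in> carrier G"
  shows "(\<lambda>z. P a b \<otimes> z) ` dc m w = dc m (P a b \<otimes> w)"
proof -
  have sub: "(\<lambda>z. P a b \<otimes> z) ` dc m w \<subseteq> dc m (P a b \<otimes> w)" if "w \<in> carrier G" for a b w
  proof
    fix u assume "u \<in> (\<lambda>z. P a b \<otimes> z) ` dc m w"
    then obtain z i j where z: "z \<in> carrier G" "u = P a b \<otimes> z" "inv w \<otimes> (P (m * i) (m * j) \<otimes> z) \<in> H"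
      unfolding dc_def dc_rel_def by blast
    have "inv (P a b \<otimes> w) \<otimes> (P (m * i) (m * j) \<otimes> u) = inv w \<otimes> (P (m * i) (m * j) \<otimes> z)"
      using that z by (simp add: inv_mult_group m_assoc P_inv P_add_left)
    then have "(P a b \<otimes> w, u) \<in> dc_rel m" using that z by (intro dc_relI[of _ m i j]) simp_all
    then show "u \<in> dc m (P a b \<otimes> w)" by (simp add: dc_def)
  qed
  have "u \<in> (\<lambda>z. P a b \<otimes> z) ` dc m w" if u: "u \<in> dc m (P a b \<otimes> w)" for u
  proof -
    have "u \<in> carrier G" using u unfolding dc_def dc_rel_def by blast
    then have "u = P a b \<otimes> (P (- a) (- b) \<otimes> u)" by (simp add: P_add_left)
    moreover have "P (- a) (- b) \<otimes> u \<in> dc m (P (- a) (- b) \<otimes> (P a b \<otimes> w))"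
      by (rule subsetD[OF sub imageI[OF u]]) (use w in simp)
    ultimately show ?thesis using w by (auto simp: P_add_left)
  qed
  then show ?thesis using sub[OF w] by blast
qed

text \<open>All translates of the cosets met by \<open>F\<close> are included, so that
  \<open>s\<close> and \<open>t\<close> act by permutations.\<close>

definition dc_space :: "int \<Rightarrow> 'a set \<Rightarrow> 'a set set" where
  "dc_space m F = (\<Union>x\<in>F. \<Union>i. \<Union>j. {dc m (P i j \<otimes> x)})"

lemma dc_in_space: "x \<in> F \<Longrightarrow> F \<subseteq> carrier G \<Longrightarrow> dc m x \<in> dc_space m F"
proof -
  assume x: "x \<in> F" "F \<subseteq> carrier G"
  then have "dc m (P 0 0 \<otimes> x) \<in> dc_space m F" unfolding dc_space_def by blast
  then show ?thesis using x by auto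
qed

lemma finite_dc_space:
  assumes m: "m > 0" and F: "finite F" "F \<subseteq> carrier G"
  shows "finite (dc_space m F)"
proof (rule finite_subset)
  show "dc_space m F \<subseteq> (\<lambda>(x, i, j). dc m (P i j \<otimes> x)) ` (F \<times> {0..<m} \<times> {0..<m})"
  proof
    fix \<omega> assume "\<omega> \<in> dc_space m F"
    then obtain x i j where x: "x \<in> F" "\<omega> = dc m (P i j \<otimes> x)" unfolding dc_space_def by blast
    then have xG: "x \<in> carrier G" using F by blast
    have "P i j \<otimes> x = P (m * (i div m)) (m * (j div m)) \<otimes> (P (i mod m) (j mod m) \<otimes> x)"
      using xG by (simp add: P_add_left)
    then have "\<omega> = dc m (P (i mod m) (j mod m) \<otimes> x)" using x xG by (simp add: dc_mult_P)
    moreover have "(x, i mod m, j mod m) \<in> F \<times> {0..<m} \<times> {0..<m}" using x m by simp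
    ultimately show "\<omega> \<in> (\<lambda>(x, i, j). dc m (P i j \<otimes> x)) ` (F \<times> {0..<m} \<times> {0..<m})"
      by (intro image_eqI[of _ _ "(x, i mod m, j mod m)"]) simp_all
  qed
qed (use F in simp)

text \<open>The restriction to \<open>dc_space m F\<close> is there because members of
  \<open>Bij\<close> are extensional.\<close>

definition translate :: "int \<Rightarrow> 'a set \<Rightarrow> int \<Rightarrow> int \<Rightarrow> 'a set \<Rightarrow> 'a set" where
  "translate m F a b = (\<lambda>\<omega>\<in>dc_space m F. (\<lambda>z. P a b \<otimes> z) ` \<omega>)"

lemma translate_apply:
  "x \<in> F \<Longrightarrow> F \<subseteq> carrier G \<Longrightarrow> translate m F a b (dc m (P i j \<otimes> x)) = dc m (P (a + i) (b + j) \<otimes> x)"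
proof -
  assume x: "x \<in> F" "F \<subseteq> carrier G"
  then have "dc m (P i j \<otimes> x) \<in> dc_space m F" "x \<in> carrier G" unfolding dc_space_def by blast+
  then show ?thesis by (simp add: translate_def translate_dc P_add_left)
qed

lemma translate_translate:
  assumes F: "F \<subseteq> carrier G" and \<omega>: "\<omega> \<in> dc_space m F"
  shows "translate m F a b \<omega> \<in> dc_space m F"
    and "translate m F a b (translate m F c d \<omega>) = translate m F (a + c) (b + d) \<omega>"
    and "translate m F 0 0 \<omega> = \<omega>"
proof -
  obtain x i j where x: "x \<in> F" "\<omega> = dc m (P i j \<otimes> x)" using \<omega> unfolding dc_space_def by blast
  show "translate m F a b (translate m F c d \<omega>) = translate m F (a + c) (b + d) \<omega>"
    "translate m F 0 0 \<omega> = \<omega>"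
    using x F by (simp_all add: translate_apply add.assoc)
  have "translate m F a b \<omega> = dc m (P (a + i) (b + j) \<otimes> x)" using x F by (simp add: translate_apply)
  then show "translate m F a b \<omega> \<in> dc_space m F" using x unfolding dc_space_def by blast
qed

lemma translate_Bij:
  assumes F: "F \<subseteq> carrier G"
  shows "translate m F a b \<in> Bij (dc_space m F)"
proof -
  have "bij_betw (translate m F a b) (dc_space m F) (dc_space m F)"
    by (rule bij_betw_byWitness[where f' = "translate m F (- a) (- b)"])
      (auto simp: translate_translate[OF F])
  then show ?thesis by (simp add: Bij_def translate_def)
qed

end

text \<open>Since every partial involution extends, the factor \<open>\<int>/2\<close> imposes no condition on the
  finite model.\<close>

lemma involution_extension:
  assumes V: "V \<subseteq> \<Omega>" "f ` V \<subseteq> V" and ff: "\<And>x. x \<in> V \<Longrightarrow> f (f x) = x"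
  obtains g where "g \<in> Bij \<Omega>" "\<And>x. x \<in> V \<Longrightarrow> g x = f x" "\<And>x. x \<in> \<Omega> \<Longrightarrow> g (g x) = x"
proof -
  define g where "g = (\<lambda>x\<in>\<Omega>. if x \<in> V then f x else x)"
  have 1: "g x = f x" if "x \<in> V" for x using that V by (auto simp: g_def)
  have 2: "g x \<in> \<Omega>" if "x \<in> \<Omega>" for x using that V by (auto simp: g_def)
  have 3: "g (g x) = x" if "x \<in> \<Omega>" for x
  proof (cases "x \<in> V")
    case True
    then have "f x \<in> V" using V by blast
    then show ?thesis using True ff 1 by simp
  next
    case False
    then show ?thesis using that by (simp add: g_def)
  qed
  have "bij_betw g \<Omega> \<Omega>" by (rule bij_betw_byWitness[where f' = g]) (use 2 3 in auto)
  then have "g \<in> Bij \<Omega>" by (simp add: Bij_def g_def)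
  then show thesis using that 1 3 by blast
qed

text \<open>The map \<open>q\<close> takes \<open>x\<close> to its double coset, with
  \<open>m\<close> chosen so that elements of \<open>F\<close> in different left cosets of
  \<open>H\<close> stay apart. The action of \<open>v\<close> is prescribed only where it stays
  within \<open>F\<close> and is then extended to an involution.\<close>

lemma (in commuting_pair) finite_model:
  assumes v: "v \<in> carrier G" and vv: "v \<otimes> v = \<one>" and F: "finite F" "F \<subseteq> carrier G"
  obtains \<Omega> :: "'a set set" and q s' t' v' where
    "finite \<Omega>" "s' \<in> Bij \<Omega>" "t' \<in> Bij \<Omega>" "v' \<in> Bij \<Omega>"
    "\<And>\<omega>. \<omega> \<in> \<Omega> \<Longrightarrow> s' (t' \<omega>) = t' (s' \<omega>)" "\<And>\<omega>. \<omega> \<in> \<Omega> \<Longrightarrow> v' (v' \<omega>) = \<omega>"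
    "q ` F \<subseteq> \<Omega>"
    "\<And>x. x \<in> F \<Longrightarrow> s' (q x) = q (s \<otimes> x)" "\<And>x. x \<in> F \<Longrightarrow> t' (q x) = q (t \<otimes> x)"
    "\<And>x. x \<in> F \<Longrightarrow> v \<otimes> x \<in> F \<Longrightarrow> v' (q x) = q (v \<otimes> x)"
    "\<And>x y. x \<in> F \<Longrightarrow> y \<in> F \<Longrightarrow> q x = q y \<longleftrightarrow> inv x \<otimes> y \<in> H"
proof -
  obtain m where m: "m > 0"
    "\<And>x y i j. x \<in> F \<Longrightarrow> y \<in> F \<Longrightarrow> inv y \<otimes> (P (m * i) (m * j) \<otimes> x) \<in> H \<Longrightarrow> inv y \<otimes> x \<in> H"
    using exists_separating_modulus[OF F] by blast
  define \<Omega> where "\<Omega> = dc_space m F"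
  have FG: "x \<in> carrier G" if "x \<in> F" for x using F that by blast
  have sep: "dc m x = dc m y \<longleftrightarrow> inv x \<otimes> y \<in> H" if "x \<in> F" "y \<in> F" for x y
  proof
    assume "dc m x = dc m y"
    then have "(x, y) \<in> dc_rel m" using FG that by (simp add: dc_eq_iff)
    then show "inv x \<otimes> y \<in> H" using m(2) that unfolding dc_rel_def by blast
  qed (use FG that dc_mult_H in blast)
  define V where "V = {x \<in> F. v \<otimes> x \<in> F}"
  have v_cancel: "v \<otimes> (v \<otimes> x) = x" if "x \<in> carrier G" for x
    using that v vv by (simp flip: m_assoc)
  have VF: "x \<in> F" "v \<otimes> x \<in> V" if "x \<in> V" for x
    using that v_cancel FG by (auto simp: V_def)
  \<comment> \<open>A representative in \<open>V\<close> is chosen. By \<open>sep\<close>, two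
    representatives lie in the same left coset of \<open>H\<close>, so the value does not depend on
    the choice.\<close>
  define f where "f \<omega> = dc m (v \<otimes> (SOME x. x \<in> V \<and> dc m x = \<omega>))" for \<omega>
  have f: "f (dc m x) = dc m (v \<otimes> x)" if x: "x \<in> V" for x
  proof -
    define y where "y = (SOME y. y \<in> V \<and> dc m y = dc m x)"
    have y: "y \<in> V \<and> dc m y = dc m x" unfolding y_def by (rule someI[of _ x]) (use x in simp)
    then have yx: "inv y \<otimes> x \<in> H" using sep VF x by blast
    have [simp]: "x \<in> carrier G" "y \<in> carrier G" using x y VF FG by blast+
    have "inv (v \<otimes> y) \<otimes> (v \<otimes> x) = inv y \<otimes> x" using v by (simp add: inv_mult_group m_assoc)
    then have "dc m (v \<otimes> y) = dc m (v \<otimes> x)" using yx v by (intro dc_mult_H) simp_all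
    then show ?thesis by (simp add: f_def y_def)
  qed
  have sub: "dc m ` V \<subseteq> \<Omega>" using dc_in_space[OF _ F(2)] VF unfolding \<Omega>_def by blast
  have inv: "f ` dc m ` V \<subseteq> dc m ` V" using f VF by auto
  have ff: "f (f \<omega>) = \<omega>" if "\<omega> \<in> dc m ` V" for \<omega>
    using that f VF v_cancel FG by auto
  obtain v' where v': "v' \<in> Bij \<Omega>" "\<And>\<omega>. \<omega> \<in> dc m ` V \<Longrightarrow> v' \<omega> = f \<omega>"
    "\<And>\<omega>. \<omega> \<in> \<Omega> \<Longrightarrow> v' (v' \<omega>) = \<omega>"
    using involution_extension[OF sub inv ff] by metis
  show thesis
  proof (rule that[of \<Omega> "translate m F 1 0" "translate m F 0 1" v' "dc m"])
    show "finite \<Omega>" unfolding \<Omega>_def by (rule finite_dc_space[OF m(1) F])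
    show "translate m F 1 0 \<in> Bij \<Omega>" "translate m F 0 1 \<in> Bij \<Omega>"
      unfolding \<Omega>_def by (rule translate_Bij[OF F(2)])+
    show "translate m F 1 0 (translate m F 0 1 \<omega>) = translate m F 0 1 (translate m F 1 0 \<omega>)"
      if "\<omega> \<in> \<Omega>" for \<omega>
      using that translate_translate(2)[OF F(2)] unfolding \<Omega>_def by simp
    show "dc m ` F \<subseteq> \<Omega>" using dc_in_space[OF _ F(2)] unfolding \<Omega>_def by blast
    show "translate m F 1 0 (dc m x) = dc m (s \<otimes> x)" "translate m F 0 1 (dc m x) = dc m (t \<otimes> x)"
      if "x \<in> F" for x
      using translate_apply[OF that F(2), of m 1 0 0 0] translate_apply[OF that F(2), of m 0 1 0 0]
        FG[OF that] by (simp_all add: P_generators)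
    show "v' (dc m x) = dc m (v \<otimes> x)" if "x \<in> F" "v \<otimes> x \<in> F" for x
      using that v'(2) f by (simp add: V_def)
  qed (use v' sep in simp_all)
qed

section \<open>The groups on two strands\<close>

lemma (in group_action) finite_rcosets_stabilizer:
  assumes "finite E" "x \<in> E"
  shows "finite (rcosets (stabilizer G \<phi> x))"
proof (rule inj_on_finite)
  \<comment> \<open>Orbit-stabilizer for right cosets: a representative is inverted before acting on
    \<open>x\<close>, so all representatives of one coset give the same point.\<close>
  show "inj_on (\<lambda>R. \<phi> (inv (SOME h. h \<in> R)) x) (rcosets (stabilizer G \<phi> x))"
    by (rule inj_onI) (rule orbit_stab_fun_is_inj[OF assms(2)])
  have G: "group G" using group_hom group_hom.axioms(1) by blast
  show "(\<lambda>R. \<phi> (inv (SOME h. h \<in> R)) x) ` (rcosets (stabilizer G \<phi> x)) \<subseteq> E"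
  proof (rule image_subsetI)
    fix R assume R: "R \<in> rcosets (stabilizer G \<phi> x)"
    have "R \<noteq> {}"
      using subgroup.rcosets_non_empty[OF stabilizer_subgroup[OF assms(2)] R] .
    then have "(SOME h. h \<in> R) \<in> R" by (simp add: some_in_eq)
    then have "inv (SOME h. h \<in> R) \<in> carrier G"
      using subgroup.rcosets_carrier[OF stabilizer_subgroup[OF assms(2)] G R] group.inv_closed[OF G] by blast
    then show "\<phi> (inv (SOME h. h \<in> R)) x \<in> E" using element_image assms(2) by blast
  qed
qed (rule assms(1))

lemma BijGroup_mult_apply:
  "g \<in> carrier (BijGroup \<Omega>) \<Longrightarrow> h \<in> carrier (BijGroup \<Omega>) \<Longrightarrow> x \<in> \<Omega> \<Longrightarrow>
    (g \<otimes>\<^bsub>BijGroup \<Omega>\<^esub> h) x = g (h x)"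
  by (simp add: BijGroup_def compose_eq)

text \<open>A finite permutation model of the left cosets of \<open>H\<close>, faithful on those met
  by \<open>F\<close>. Generators imitate left multiplication as long as it stays in
  \<open>F\<close>; inverse letters are covered because \<open>f x\<close> is a bijection.\<close>

definition finite_coset_model ::
    "'g set \<Rightarrow> ('g letters \<times> 'g letters) set \<Rightarrow> 'g letters set set \<Rightarrow> 'g letters set set \<Rightarrow>
      'b set \<Rightarrow> ('g letters set \<Rightarrow> 'b) \<Rightarrow> ('g \<Rightarrow> 'b \<Rightarrow> 'b) \<Rightarrow> bool"
  where "finite_coset_model S R H F \<Omega> q f \<longleftrightarrow>
    finite \<Omega> \<and> q ` F \<subseteq> \<Omega> \<and> f ` S \<subseteq> carrier (BijGroup \<Omega>) \<and>
    (\<forall>l r. (l, r) \<in> R \<longrightarrow> word_value (BijGroup \<Omega>) f l = word_value (BijGroup \<Omega>) f r) \<and>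
    (\<forall>x\<in>S. \<forall>y\<in>F. pres_class S R [(x, True)] \<otimes>\<^bsub>presented_group S R\<^esub> y \<in> F \<longrightarrow>
      f x (q y) = q (pres_class S R [(x, True)] \<otimes>\<^bsub>presented_group S R\<^esub> y)) \<and>
    (\<forall>x\<in>F. \<forall>y\<in>F. q x = q y \<longleftrightarrow> inv\<^bsub>presented_group S R\<^esub> x \<otimes>\<^bsub>presented_group S R\<^esub> y \<in> H)"

lemma LERF_presented_groupI:
  fixes S :: "'g set" and R
  defines "G \<equiv> presented_group S R"
  assumes model: "\<And>F H. finite F \<Longrightarrow> F \<subseteq> carrier G \<Longrightarrow> subgroup H G \<Longrightarrow>
    \<exists>(\<Omega> :: 'b set) q f. finite_coset_model S R H F \<Omega> q f"
  shows "LERF G"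
proof -
  interpret G: group G unfolding G_def by (rule group_presented_group)
  let ?c = "pres_class S R"
  have carr: "carrier G = ?c ` words S" unfolding G_def by (rule carrier_presented_group)
  show ?thesis
    unfolding G.LERF_iff_separates
  proof (intro allI impI)
    fix A g assume A: "A \<subseteq> carrier G" "finite A" and g: "g \<in> carrier G - generate G A"
    define H where "H = generate G A"
    have H: "subgroup H G" unfolding H_def by (rule G.generate_is_subgroup[OF A(1)])
    define w where "w a = (SOME w. w \<in> words S \<and> a = ?c w)" for a
    have w: "w a \<in> words S" "?c (w a) = a" if "a \<in> carrier G" for a
    proof -
      have "\<exists>w. w \<in> words S \<and> a = ?c w" using that carr by blast
      then have "w a \<in> words S \<and> a = ?c (w a)" unfolding w_def by (rule someI_ex)
      then show "w a \<in> words S" "?c (w a) = a" by simp_all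
    qed
    define B where "B = insert g A"
    have B: "finite B" "B \<subseteq> carrier G" using A g by (auto simp: B_def)
    \<comment> \<open>Words act from their right end, so the word \<open>w a\<close> moves the
      identity through the classes of its suffixes. As these lie in \<open>F\<close>, the model
      follows the whole path from the base point to \<open>q a\<close>.\<close>
    define F where "F = (\<Union>a\<in>B. (\<lambda>k. ?c (drop k (w a))) ` {..length (w a)})"
    have F: "finite F" unfolding F_def using B(1) by (intro finite_UN_I finite_imageI finite_atMost)
    have dropS: "drop k (w a) \<in> words S" if "a \<in> B" for a k
      using w(1)[OF subsetD[OF B(2) that]] append_take_drop_id[of k "w a"] words_simps(3) by metis
    have FG: "F \<subseteq> carrier G" unfolding F_def carr by (intro UN_least image_subsetI imageI dropS)
    have dropF: "?c (drop k (w a)) \<in> F" if "a \<in> B" "k \<le> length (w a)" for a k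
      unfolding F_def using that by blast
    have one: "\<one>\<^bsub>G\<^esub> = ?c []" unfolding G_def by (rule one_presented_group)
    have oneF: "\<one>\<^bsub>G\<^esub> \<in> F" using dropF[of g "length (w g)"] by (simp add: B_def one)
    have BF: "a \<in> F" if "a \<in> B" for a using dropF[OF that, of 0] w(2)[OF subsetD[OF B(2) that]] by simp
    obtain \<Omega> :: "'b set" and q f where M: "finite_coset_model S R H F \<Omega> q f"
      using model[OF F FG H] by blast
    have \<Omega>: "finite \<Omega>" and q: "q ` F \<subseteq> \<Omega>" and f: "f ` S \<subseteq> carrier (BijGroup \<Omega>)"
      using M by (simp_all add: finite_coset_model_def)
    have R: "word_value (BijGroup \<Omega>) f l = word_value (BijGroup \<Omega>) f r" if "(l, r) \<in> R" for l r
      using M that by (simp add: finite_coset_model_def)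
    have f_q: "f x (q y) = q (?c [(x, True)] \<otimes>\<^bsub>G\<^esub> y)"
      if "x \<in> S" "y \<in> F" "?c [(x, True)] \<otimes>\<^bsub>G\<^esub> y \<in> F" for x y
      using M that by (simp add: finite_coset_model_def G_def)
    have sep: "q x = q y \<longleftrightarrow> inv\<^bsub>G\<^esub> x \<otimes>\<^bsub>G\<^esub> y \<in> H" if "x \<in> F" "y \<in> F" for x y
      using M that by (simp add: finite_coset_model_def G_def)
    define \<rho> where "\<rho> = pres_lift (BijGroup \<Omega>) f"
    interpret Bij: group "BijGroup \<Omega>" by (rule group_BijGroup)
    have "\<rho> \<in> hom G (BijGroup \<Omega>)" unfolding \<rho>_def G_def by (rule Bij.pres_lift_hom[OF f R])
    then interpret act: group_action G \<Omega> \<rho>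
      by (simp add: group_action_def group_hom_def group_hom_axioms_def G.group_axioms group_BijGroup)
    have f_inv: "(inv\<^bsub>BijGroup \<Omega>\<^esub> f x) (q y) = q z"
      if "x \<in> S" "y \<in> F" "z \<in> F" "?c [(x, True)] \<otimes>\<^bsub>G\<^esub> z = y" for x y z
    proof -
      have fB: "f x \<in> Bij \<Omega>" using f that(1) by (auto simp: BijGroup_def)
      have "f x (q z) = q y" using f_q[OF that(1,3)] that(2,4) by simp
      moreover have "q z \<in> \<Omega>" "q y \<in> \<Omega>" using q that by blast+
      ultimately show ?thesis
        using fB inv_into_f_f[of "f x" \<Omega> "q z"] by (simp add: inv_BijGroup Bij_def bij_betw_def)
    qed
    have word_q: "word_value (BijGroup \<Omega>) f u (q \<one>\<^bsub>G\<^esub>) = q (?c u)"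
      if "u \<in> words S" "\<And>k. k \<le> length u \<Longrightarrow> ?c (drop k u) \<in> F" for u
      using that
    proof (induction u)
      case Nil
      have "q \<one>\<^bsub>G\<^esub> \<in> \<Omega>" using q oneF by blast
      then show ?case by (simp add: word_value_def BijGroup_def one)
    next
      case (Cons a u)
      obtain x b where a: "a = (x, b)" by fastforce
      have x: "x \<in> S" and u: "u \<in> words S" using Cons.prems(1) a by simp_all
      have uF: "?c u \<in> F" "?c (a # u) \<in> F" using Cons.prems(2)[of 1] Cons.prems(2)[of 0] by simp_all
      have IH: "word_value (BijGroup \<Omega>) f u (q \<one>\<^bsub>G\<^esub>) = q (?c u)"
        using u Cons.prems(2)[of "Suc _"] by (intro Cons.IH) simp_all
      define h where "h = (if b then f x else inv\<^bsub>BijGroup \<Omega>\<^esub> f x)"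
      have "f x \<in> carrier (BijGroup \<Omega>)" using f x by blast
      then have h: "h \<in> carrier (BijGroup \<Omega>)" by (simp add: h_def)
      have "h (q (?c u)) = q (?c (a # u))"
      proof (cases b)
        case True
        have "?c [(x, True)] \<otimes>\<^bsub>G\<^esub> ?c u = ?c (a # u)"
          using mult_presented_group[of "[(x, True)]" S u R] x u a True by (simp add: G_def)
        then show ?thesis using f_q[OF x uF(1)] uF(2) True by (simp add: h_def)
      next
        case False
        have "pres_eq S R ([] @ [(x, True), (x, \<not> True)] @ u) ([] @ u)"
          using x u by (intro pres_eq.cancel) simp_all
        then have "?c [(x, True)] \<otimes>\<^bsub>G\<^esub> ?c (a # u) = ?c u"
          using mult_presented_group[of "[(x, True)]" S "a # u" R] x u a False
          by (simp add: G_def pres_class_eq_iff)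
        then show ?thesis using f_inv[OF x uF] False by (simp add: h_def)
      qed
      moreover have "word_value (BijGroup \<Omega>) f (a # u) = h \<otimes>\<^bsub>BijGroup \<Omega>\<^esub> word_value (BijGroup \<Omega>) f u"
        by (simp add: word_value_def a h_def)
      moreover have "q \<one>\<^bsub>G\<^esub> \<in> \<Omega>" using q oneF by blast
      moreover have "word_value (BijGroup \<Omega>) f u \<in> carrier (BijGroup \<Omega>)"
        by (rule Bij.word_value_closed[OF f u])
      ultimately show ?case using h IH by (simp only: BijGroup_mult_apply)
    qed
    have \<rho>: "\<rho> a (q \<one>\<^bsub>G\<^esub>) = q a" if "a \<in> B" for a
    proof -
      have aG: "a \<in> carrier G" using that B(2) by blast
      have "\<rho> (?c (w a)) = word_value (BijGroup \<Omega>) f (w a)"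
        unfolding \<rho>_def by (rule Bij.pres_lift_class[OF f R w(1)[OF aG]])
      then show ?thesis using word_q[OF w(1)[OF aG] dropF[OF that]] w(2)[OF aG] by simp
    qed
    have \<omega>: "q \<one>\<^bsub>G\<^esub> \<in> \<Omega>" using q oneF by blast
    have stab: "a \<in> stabilizer G \<rho> (q \<one>\<^bsub>G\<^esub>) \<longleftrightarrow> a \<in> H" if "a \<in> B" for a
    proof -
      have aG: "a \<in> carrier G" using that B(2) by blast
      then have "q a = q \<one>\<^bsub>G\<^esub> \<longleftrightarrow> a \<in> H"
        using sep[OF oneF BF[OF that]] by (simp add: eq_commute[of "q a"])
      then show ?thesis by (simp only: stabilizer_def mem_Collect_eq \<rho>[OF that] aG simp_thms)
    qed
    show "\<exists>K. subgroup K G \<and> finite (rcosets\<^bsub>G\<^esub> K) \<and> A \<subseteq> K \<and> g \<notin> K"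
    proof (intro exI conjI)
      show "subgroup (stabilizer G \<rho> (q \<one>\<^bsub>G\<^esub>)) G" by (rule act.stabilizer_subgroup[OF \<omega>])
      show "finite (rcosets\<^bsub>G\<^esub> stabilizer G \<rho> (q \<one>\<^bsub>G\<^esub>))"
        by (rule act.finite_rcosets_stabilizer[OF \<Omega> \<omega>])
      show "A \<subseteq> stabilizer G \<rho> (q \<one>\<^bsub>G\<^esub>)"
        using stab unfolding B_def H_def by (blast intro: generate.incl)
      show "g \<notin> stabilizer G \<rho> (q \<one>\<^bsub>G\<^esub>)" using stab[of g] g unfolding B_def H_def by blast
    qed
  qed
qed

lemma pres_class_rel:
  assumes "(l, r) \<in> R" "l \<in> words S" "r \<in> words S"
  shows "pres_class S R l = pres_class S R r"
proof -
  have "pres_eq S R ([] @ l @ []) ([] @ r @ [])" using assms by (intro pres_eq.rel) simp_all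
  then show ?thesis using assms by (simp add: pres_class_eq_iff)
qed

lemma pres_class_mult_gens:
  assumes "x \<in> S" "y \<in> S"
  shows "pres_class S R [(x, True)] \<otimes>\<^bsub>presented_group S R\<^esub> pres_class S R [(y, True)] =
    pres_class S R (pos [x, y])"
  using assms by (simp add: mult_presented_group pos_def)

section \<open>The two-strand groups by their presentations\<close>

lemma VSG_2:
  "VSG_gens 2 = {Sig 1, Tau 1, Vir 1}"
  "VSG_rels 2 = {(pos [Vir 1, Vir 1], []), (pos [Sig 1, Tau 1], pos [Tau 1, Sig 1])}"
  unfolding VSG_gens_def VSG_rels_def by auto

text \<open>With a single index no relation between neighbouring or distant generators remains. The
  group is the free product of \<int> \<times> \<int> and \<int>/2, whose two relations hold for the
  permutations of \<open>finite_model\<close>.\<close>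

lemma LERF_VSG_2: "LERF (VSG 2)"
  unfolding VSG_def
proof (rule LERF_presented_groupI)
  let ?S = "VSG_gens 2" and ?R = "VSG_rels 2"
  let ?G = "presented_group ?S ?R" and ?c = "\<lambda>x. pres_class ?S ?R [(x, True)]"
  fix F H assume F: "finite F" "F \<subseteq> carrier ?G" and H: "subgroup H ?G"
  interpret G: group ?G by (rule group_presented_group)
  have gens_closed: "?c (Sig 1) \<in> carrier ?G" "?c (Tau 1) \<in> carrier ?G" "?c (Vir 1) \<in> carrier ?G"
    by (auto simp: carrier_presented_group VSG_2(1))
  have mem: "Sig 1 \<in> ?S" "Tau 1 \<in> ?S" "Vir 1 \<in> ?S" by (simp_all add: VSG_2(1))
  have "?c (Sig 1) \<otimes>\<^bsub>?G\<^esub> ?c (Tau 1) = ?c (Tau 1) \<otimes>\<^bsub>?G\<^esub> ?c (Sig 1)"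
    unfolding pres_class_mult_gens[OF mem(1,2)] pres_class_mult_gens[OF mem(2,1)]
    by (rule pres_class_rel) (use mem in \<open>simp_all add: VSG_2(2) pos_def\<close>)
  then interpret commuting_pair ?G "?c (Sig 1)" "?c (Tau 1)" H
    using gens_closed H by (simp add: commuting_pair_def commuting_pair_axioms_def G.group_axioms)
  have vv: "?c (Vir 1) \<otimes>\<^bsub>?G\<^esub> ?c (Vir 1) = \<one>\<^bsub>?G\<^esub>"
    unfolding pres_class_mult_gens[OF mem(3,3)] one_presented_group
    by (rule pres_class_rel) (use mem in \<open>simp_all add: VSG_2(2) pos_def\<close>)
  obtain \<Omega> :: "braid_gen letters set set set" and q s' t' v' where
    \<Omega>: "finite \<Omega>" "s' \<in> Bij \<Omega>" "t' \<in> Bij \<Omega>" "v' \<in> Bij \<Omega>"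
    and rels: "\<And>\<omega>. \<omega> \<in> \<Omega> \<Longrightarrow> s' (t' \<omega>) = t' (s' \<omega>)" "\<And>\<omega>. \<omega> \<in> \<Omega> \<Longrightarrow> v' (v' \<omega>) = \<omega>"
    and q: "q ` F \<subseteq> \<Omega>"
    and act: "\<And>x. x \<in> F \<Longrightarrow> s' (q x) = q (?c (Sig 1) \<otimes>\<^bsub>?G\<^esub> x)"
      "\<And>x. x \<in> F \<Longrightarrow> t' (q x) = q (?c (Tau 1) \<otimes>\<^bsub>?G\<^esub> x)"
      "\<And>x. x \<in> F \<Longrightarrow> ?c (Vir 1) \<otimes>\<^bsub>?G\<^esub> x \<in> F \<Longrightarrow> v' (q x) = q (?c (Vir 1) \<otimes>\<^bsub>?G\<^esub> x)"
    and sep: "\<And>x y. x \<in> F \<Longrightarrow> y \<in> F \<Longrightarrow> q x = q y \<longleftrightarrow> inv\<^bsub>?G\<^esub> x \<otimes>\<^bsub>?G\<^esub> y \<in> H"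
    by (rule finite_model[OF gens_closed(3) vv F], rule that)
  define f where "f x = (case x of Sig _ \<Rightarrow> s' | Tau _ \<Rightarrow> t' | Vir _ \<Rightarrow> v')" for x
  interpret Bij: group "BijGroup \<Omega>" by (rule group_BijGroup)
  have carr: "s' \<in> carrier (BijGroup \<Omega>)" "t' \<in> carrier (BijGroup \<Omega>)" "v' \<in> carrier (BijGroup \<Omega>)"
    using \<Omega> by (simp_all add: BijGroup_def)
  have "s' \<otimes>\<^bsub>BijGroup \<Omega>\<^esub> t' = t' \<otimes>\<^bsub>BijGroup \<Omega>\<^esub> s'" "v' \<otimes>\<^bsub>BijGroup \<Omega>\<^esub> v' = \<one>\<^bsub>BijGroup \<Omega>\<^esub>"
    using \<Omega> rels by (auto simp: BijGroup_def compose_def fun_eq_iff)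
  then have "\<forall>l r. (l, r) \<in> ?R \<longrightarrow> word_value (BijGroup \<Omega>) f l = word_value (BijGroup \<Omega>) f r"
    using carr by (simp add: VSG_2(2) word_value_def pos_def f_def)
  moreover have "f ` ?S \<subseteq> carrier (BijGroup \<Omega>)" using carr by (simp add: VSG_2(1) f_def)
  moreover have "\<forall>x\<in>?S. \<forall>y\<in>F. ?c x \<otimes>\<^bsub>?G\<^esub> y \<in> F \<longrightarrow> f x (q y) = q (?c x \<otimes>\<^bsub>?G\<^esub> y)"
    using act unfolding VSG_2(1) f_def by simp
  ultimately have "finite_coset_model ?S ?R H F \<Omega> q f"
    using \<Omega>(1) q sep by (simp add: finite_coset_model_def)
  then show "\<exists>(\<Omega> :: braid_gen letters set set set) q f. finite_coset_model ?S ?R H F \<Omega> q f"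
    by blast
qed

lemma VB_2: "VB_gens 2 = {Sig 1, Vir 1}" "VB_rels 2 = {(pos [Vir 1, Vir 1], [])}"
  unfolding VB_gens_def VB_rels_def by auto

lemma LERF_VB_2: "LERF (VB 2)"
  unfolding VB_def
proof (rule LERF_presented_groupI)
  let ?S = "VB_gens 2" and ?R = "VB_rels 2"
  let ?G = "presented_group ?S ?R" and ?c = "\<lambda>x. pres_class ?S ?R [(x, True)]"
  fix F H assume F: "finite F" "F \<subseteq> carrier ?G" and H: "subgroup H ?G"
  interpret G: group ?G by (rule group_presented_group)
  have mem: "Sig 1 \<in> ?S" "Vir 1 \<in> ?S" by (simp_all add: VB_2(1))
  have gens_closed: "?c x \<in> carrier ?G" if "x \<in> ?S" for x
    using that by (simp add: carrier_presented_group)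
  have vv: "?c (Vir 1) \<otimes>\<^bsub>?G\<^esub> ?c (Vir 1) = \<one>\<^bsub>?G\<^esub>"
    unfolding pres_class_mult_gens[OF mem(2,2)] one_presented_group
    by (rule pres_class_rel) (use mem in \<open>simp_all add: VB_2(2) pos_def\<close>)
  \<comment> \<open>Taking the identity as second commuting element lets \<open>finite_model\<close>
    cover the free product of \<int> and \<int>/2.\<close>
  interpret commuting_pair ?G "?c (Sig 1)" "\<one>\<^bsub>?G\<^esub>" H
    using gens_closed mem H by (simp add: commuting_pair_def commuting_pair_axioms_def G.group_axioms)
  obtain \<Omega> :: "braid_gen letters set set set" and q s' t' v' where
    \<Omega>: "finite \<Omega>" "s' \<in> Bij \<Omega>" "t' \<in> Bij \<Omega>" "v' \<in> Bij \<Omega>"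
    and rels: "\<And>\<omega>. \<omega> \<in> \<Omega> \<Longrightarrow> s' (t' \<omega>) = t' (s' \<omega>)" "\<And>\<omega>. \<omega> \<in> \<Omega> \<Longrightarrow> v' (v' \<omega>) = \<omega>"
    and q: "q ` F \<subseteq> \<Omega>"
    and act: "\<And>x. x \<in> F \<Longrightarrow> s' (q x) = q (?c (Sig 1) \<otimes>\<^bsub>?G\<^esub> x)"
      "\<And>x. x \<in> F \<Longrightarrow> t' (q x) = q (\<one>\<^bsub>?G\<^esub> \<otimes>\<^bsub>?G\<^esub> x)"
      "\<And>x. x \<in> F \<Longrightarrow> ?c (Vir 1) \<otimes>\<^bsub>?G\<^esub> x \<in> F \<Longrightarrow> v' (q x) = q (?c (Vir 1) \<otimes>\<^bsub>?G\<^esub> x)"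
    and sep: "\<And>x y. x \<in> F \<Longrightarrow> y \<in> F \<Longrightarrow> q x = q y \<longleftrightarrow> inv\<^bsub>?G\<^esub> x \<otimes>\<^bsub>?G\<^esub> y \<in> H"
    by (rule finite_model[OF gens_closed[OF mem(2)] vv F], rule that)
  define f where "f x = (case x of Vir _ \<Rightarrow> v' | _ \<Rightarrow> s')" for x
  interpret Bij: group "BijGroup \<Omega>" by (rule group_BijGroup)
  have carr: "s' \<in> carrier (BijGroup \<Omega>)" "v' \<in> carrier (BijGroup \<Omega>)"
    using \<Omega> by (simp_all add: BijGroup_def)
  have "v' \<otimes>\<^bsub>BijGroup \<Omega>\<^esub> v' = \<one>\<^bsub>BijGroup \<Omega>\<^esub>"
    using \<Omega> rels by (auto simp: BijGroup_def compose_def fun_eq_iff)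
  then have "\<forall>l r. (l, r) \<in> ?R \<longrightarrow> word_value (BijGroup \<Omega>) f l = word_value (BijGroup \<Omega>) f r"
    using carr by (simp add: VB_2(2) word_value_def pos_def f_def)
  moreover have "f ` ?S \<subseteq> carrier (BijGroup \<Omega>)" using carr by (simp add: VB_2(1) f_def)
  moreover have "\<forall>x\<in>?S. \<forall>y\<in>F. ?c x \<otimes>\<^bsub>?G\<^esub> y \<in> F \<longrightarrow> f x (q y) = q (?c x \<otimes>\<^bsub>?G\<^esub> y)"
    using act unfolding VB_2(1) f_def by simp
  ultimately have "finite_coset_model ?S ?R H F \<Omega> q f"
    using \<Omega>(1) q sep by (simp add: finite_coset_model_def)
  then show "\<exists>(\<Omega> :: braid_gen letters set set set) q f. finite_coset_model ?S ?R H F \<Omega> q f"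
    by blast
qed

section \<open>Failure of separability from three strands on\<close>

lemma group_hom_braid_perm:
  "group_hom (VB n) (sym_group n) (braid_perm n)" "group_hom (VSG n) (sym_group n) (braid_perm n)"
  by (auto simp: group_hom_def group_hom_axioms_def group_VB group_VSG sym_group_is_group
      braid_perm_hom_VB braid_perm_hom_VSG)

lemma strand_act_hom:
  "pres_lift (BijGroup UNIV) strand_act \<in> hom (VB n) (BijGroup UNIV)"
  "pres_lift (BijGroup UNIV) strand_act \<in> hom (VSG n) (BijGroup UNIV)"
proof -
  have closed: "strand_act ` S \<subseteq> carrier (BijGroup UNIV)" for S
    by (auto simp: carrier_BijGroup_UNIV bij_strand_act)
  show "pres_lift (BijGroup UNIV) strand_act \<in> hom (VB n) (BijGroup UNIV)"
    unfolding VB_def by (rule group.pres_lift_hom[OF group_BijGroup closed VB_rels_strand_act])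
  show "pres_lift (BijGroup UNIV) strand_act \<in> hom (VSG n) (BijGroup UNIV)"
    unfolding VSG_def by (rule group.pres_lift_hom[OF group_BijGroup closed VSG_rels_strand_act])
qed

lemma pres_lift_strand_act_gen:
  assumes "x \<in> S" "\<And>l r. (l, r) \<in> R \<Longrightarrow>
    word_value (BijGroup UNIV) strand_act l = word_value (BijGroup UNIV) strand_act r"
  shows "pres_lift (BijGroup UNIV) strand_act (pres_class S R (pos [x])) = strand_act x"
proof -
  have "strand_act ` S \<subseteq> carrier (BijGroup UNIV)"
    by (auto simp: carrier_BijGroup_UNIV bij_strand_act)
  moreover have "pos [x] \<in> words S" using assms(1) by (simp add: pos_def)
  ultimately have "pres_lift (BijGroup UNIV) strand_act (pres_class S R (pos [x])) =
      word_value (BijGroup UNIV) strand_act (pos [x])"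
    using assms(2) by (intro group.pres_lift_class[OF group_BijGroup]) blast+
  then show ?thesis by (simp only: word_value_strand_act comp_id)
qed

lemma pres_class_mult_gens3:
  assumes "x \<in> S" "y \<in> S" "z \<in> S"
  shows "pres_class S R (pos [x]) \<otimes>\<^bsub>presented_group S R\<^esub>
    (pres_class S R (pos [y]) \<otimes>\<^bsub>presented_group S R\<^esub> pres_class S R (pos [z])) =
    pres_class S R (pos [x, y, z])"
  using assms by (simp add: mult_presented_group pos_def)

lemma not_LERF_VP:
  assumes n: "n \<ge> 3"
  shows "\<not> LERF (VP n)"
proof -
  let ?S = "VB_gens n" and ?R = "VB_rels n"
  let ?c = "\<lambda>x. pres_class ?S ?R (pos [x])"
  have mem: "Sig 1 \<in> ?S" "Sig 2 \<in> ?S" "Vir 1 \<in> ?S" "Vir 2 \<in> ?S"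
    using n by (auto simp: VB_gens_def)
  have idx: "(1::nat) \<in> {1..n-1}" "(2::nat) \<in> {1..n-1}" "(1::nat) \<in> {1..n-2}" using n by auto
  have rels: "(pos [Vir 1, Vir 1], []) \<in> ?R" "(pos [Vir 2, Vir 2], []) \<in> ?R"
    "(pos [Vir 1, Vir (1+1), Vir 1], pos [Vir (1+1), Vir 1, Vir (1+1)]) \<in> ?R"
    "(pos [Sig 1, Sig (1+1), Sig 1], pos [Sig (1+1), Sig 1, Sig (1+1)]) \<in> ?R"
    "(pos [Vir 1, Vir (1+1), Sig 1], pos [Sig (1+1), Vir 1, Vir (1+1)]) \<in> ?R"
    unfolding VB_rels_def using idx by blast+
  have words: "pos xs \<in> words ?S" if "set xs \<subseteq> ?S" for xs
    using that by (induction xs) (auto simp: pos_def)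
  note mult = pres_class_mult_gens3[of _ "VB_gens n" _ _ "VB_rels n", folded VB_def]
  have "virtual_braid_quotient (VB n) n (braid_perm n) (pres_lift (BijGroup UNIV) strand_act)
      (?c (Sig 1)) (?c (Sig 2)) (?c (Vir 1)) (?c (Vir 2))"
  proof (intro virtual_braid_quotient.intro virtual_braid_quotient_axioms.intro)
    show "?c (Sig 1) \<in> carrier (VB n)" "?c (Sig 2) \<in> carrier (VB n)"
      "?c (Vir 1) \<in> carrier (VB n)" "?c (Vir 2) \<in> carrier (VB n)"
      unfolding VB_def carrier_presented_group using mem by (intro imageI words; simp)+
    show "?c (Vir 1) \<otimes>\<^bsub>VB n\<^esub> ?c (Vir 1) = \<one>\<^bsub>VB n\<^esub>" "?c (Vir 2) \<otimes>\<^bsub>VB n\<^esub> ?c (Vir 2) = \<one>\<^bsub>VB n\<^esub>"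
      using pres_class_rel[OF rels(1)] pres_class_rel[OF rels(2)] mem
      by (simp_all add: VB_def mult_presented_group one_presented_group pos_def)
    show "?c (Vir 2) \<otimes>\<^bsub>VB n\<^esub> (?c (Vir 1) \<otimes>\<^bsub>VB n\<^esub> ?c (Vir 2)) = ?c (Vir 1) \<otimes>\<^bsub>VB n\<^esub> (?c (Vir 2) \<otimes>\<^bsub>VB n\<^esub> ?c (Vir 1))"
      "?c (Sig 1) \<otimes>\<^bsub>VB n\<^esub> (?c (Sig 2) \<otimes>\<^bsub>VB n\<^esub> ?c (Sig 1)) = ?c (Sig 2) \<otimes>\<^bsub>VB n\<^esub> (?c (Sig 1) \<otimes>\<^bsub>VB n\<^esub> ?c (Sig 2))"
      "?c (Sig 2) \<otimes>\<^bsub>VB n\<^esub> (?c (Vir 1) \<otimes>\<^bsub>VB n\<^esub> ?c (Vir 2)) = ?c (Vir 1) \<otimes>\<^bsub>VB n\<^esub> (?c (Vir 2) \<otimes>\<^bsub>VB n\<^esub> ?c (Sig 1))"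
      using rels(3-5)[THEN pres_class_rel, OF words words] mem by (simp_all add: mult numeral_2_eq_2)
    show "braid_perm n (?c (Sig 1)) = transpose 1 2" "braid_perm n (?c (Sig 2)) = transpose 2 3"
      "braid_perm n (?c (Vir 1)) = transpose 1 2" "braid_perm n (?c (Vir 2)) = transpose 2 3"
      using mem by (simp_all add: braid_perm_gen_VB flip: numeral_2_eq_2)
    show "pres_lift (BijGroup UNIV) strand_act (?c (Sig 1)) = strand_act (Sig 1)"
      "pres_lift (BijGroup UNIV) strand_act (?c (Sig 2)) = strand_act (Sig 2)"
      "pres_lift (BijGroup UNIV) strand_act (?c (Vir 1)) = strand_act (Vir 1)"
      "pres_lift (BijGroup UNIV) strand_act (?c (Vir 2)) = strand_act (Vir 2)"
      by (intro pres_lift_strand_act_gen mem VB_rels_strand_act; assumption)+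
  qed (rule group_hom_braid_perm strand_act_hom)+
  then show ?thesis unfolding VP_def by (rule virtual_braid_quotient.not_LERF_pure)
qed

lemma not_LERF_VSPG:
  assumes n: "n \<ge> 3"
  shows "\<not> LERF (VSPG n)"
proof -
  let ?S = "VSG_gens n" and ?R = "VSG_rels n"
  let ?c = "\<lambda>x. pres_class ?S ?R (pos [x])"
  have mem: "Sig 1 \<in> ?S" "Sig 2 \<in> ?S" "Vir 1 \<in> ?S" "Vir 2 \<in> ?S"
    using n by (auto simp: VSG_gens_def)
  have idx: "(1::nat) \<in> {1..n-1}" "(2::nat) \<in> {1..n-1}" "\<bar>int 1 - int 2\<bar> = 1" using n by auto
  have rels: "(pos [Vir 1, Vir 1], []) \<in> ?R" "(pos [Vir 2, Vir 2], []) \<in> ?R"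
    "(pos [Vir 1, Vir 2, Vir 1], pos [Vir 2, Vir 1, Vir 2]) \<in> ?R"
    "(pos [Sig 1, Sig 2, Sig 1], pos [Sig 2, Sig 1, Sig 2]) \<in> ?R"
    "(pos [Vir 1, Sig 2, Vir 1], pos [Vir 2, Sig 1, Vir 2]) \<in> ?R"
    unfolding VSG_rels_def using idx by blast+
  have words: "pos xs \<in> words ?S" if "set xs \<subseteq> ?S" for xs
    using that by (induction xs) (auto simp: pos_def)
  note mult = pres_class_mult_gens3[of _ "VSG_gens n" _ _ "VSG_rels n", folded VSG_def]
  interpret G: group "VSG n" by (rule group_VSG)
  have closed: "?c (Sig 1) \<in> carrier (VSG n)" "?c (Sig 2) \<in> carrier (VSG n)"
    "?c (Vir 1) \<in> carrier (VSG n)" "?c (Vir 2) \<in> carrier (VSG n)"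
    unfolding VSG_def carrier_presented_group using mem by (intro imageI words; simp)+
  have vv: "?c (Vir 1) \<otimes>\<^bsub>VSG n\<^esub> ?c (Vir 1) = \<one>\<^bsub>VSG n\<^esub>" "?c (Vir 2) \<otimes>\<^bsub>VSG n\<^esub> ?c (Vir 2) = \<one>\<^bsub>VSG n\<^esub>"
    using pres_class_rel[OF rels(1)] pres_class_rel[OF rels(2)] mem
    by (simp_all add: VSG_def mult_presented_group one_presented_group pos_def)
  have rels3: "?c (Vir 2) \<otimes>\<^bsub>VSG n\<^esub> (?c (Vir 1) \<otimes>\<^bsub>VSG n\<^esub> ?c (Vir 2)) = ?c (Vir 1) \<otimes>\<^bsub>VSG n\<^esub> (?c (Vir 2) \<otimes>\<^bsub>VSG n\<^esub> ?c (Vir 1))"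
    "?c (Sig 1) \<otimes>\<^bsub>VSG n\<^esub> (?c (Sig 2) \<otimes>\<^bsub>VSG n\<^esub> ?c (Sig 1)) = ?c (Sig 2) \<otimes>\<^bsub>VSG n\<^esub> (?c (Sig 1) \<otimes>\<^bsub>VSG n\<^esub> ?c (Sig 2))"
    "?c (Vir 1) \<otimes>\<^bsub>VSG n\<^esub> (?c (Sig 2) \<otimes>\<^bsub>VSG n\<^esub> ?c (Vir 1)) = ?c (Vir 2) \<otimes>\<^bsub>VSG n\<^esub> (?c (Sig 1) \<otimes>\<^bsub>VSG n\<^esub> ?c (Vir 2))"
    using rels(3-5)[THEN pres_class_rel, OF words words] mem by (simp_all add: mult)
  have svv: "?c (Sig 2) \<otimes>\<^bsub>VSG n\<^esub> (?c (Vir 1) \<otimes>\<^bsub>VSG n\<^esub> ?c (Vir 2)) = ?c (Vir 1) \<otimes>\<^bsub>VSG n\<^esub> (?c (Vir 2) \<otimes>\<^bsub>VSG n\<^esub> ?c (Sig 1))"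
    by (rule G.virtual_mixed_relation[OF closed vv rels3(3)])
  have "virtual_braid_quotient (VSG n) n (braid_perm n) (pres_lift (BijGroup UNIV) strand_act)
      (?c (Sig 1)) (?c (Sig 2)) (?c (Vir 1)) (?c (Vir 2))"
  proof (intro virtual_braid_quotient.intro virtual_braid_quotient_axioms.intro)
    show "braid_perm n (?c (Sig 1)) = transpose 1 2" "braid_perm n (?c (Sig 2)) = transpose 2 3"
      "braid_perm n (?c (Vir 1)) = transpose 1 2" "braid_perm n (?c (Vir 2)) = transpose 2 3"
      using mem by (simp_all add: braid_perm_gen_VSG flip: numeral_2_eq_2)
    show "pres_lift (BijGroup UNIV) strand_act (?c (Sig 1)) = strand_act (Sig 1)"
      "pres_lift (BijGroup UNIV) strand_act (?c (Sig 2)) = strand_act (Sig 2)"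
      "pres_lift (BijGroup UNIV) strand_act (?c (Vir 1)) = strand_act (Vir 1)"
      "pres_lift (BijGroup UNIV) strand_act (?c (Vir 2)) = strand_act (Vir 2)"
      by (intro pres_lift_strand_act_gen mem VSG_rels_strand_act; assumption)+
  qed (rule group_hom_braid_perm strand_act_hom closed vv rels3 svv)+
  then show ?thesis unfolding VSPG_def by (rule virtual_braid_quotient.not_LERF_pure)
qed

theorem theorem29:
  fixes n :: nat
  assumes "n \<ge> 2"
  shows "((LERF (VB n) \<longleftrightarrow> n = 2) \<and> (LERF (VP n) \<longleftrightarrow> n = 2)) \<and>
         ((LERF (VSG n) \<longleftrightarrow> n = 2) \<and> (LERF (VSPG n) \<longleftrightarrow> n = 2))"
proof -
  \<comment> \<open>Since LERF passes to subgroups, it suffices to establish it for the full groups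
    when \<open>n = 2\<close> and to refute it for the pure groups when
    \<open>n \<ge> 3\<close>.\<close>
  have VP: "LERF (VP n)" if "LERF (VB n)" for n
    unfolding VP_def using group.LERF_subgroup[OF group_VB that] group_hom.subgroup_kernel[OF group_hom_braid_perm(1)] .
  have VSPG: "LERF (VSPG n)" if "LERF (VSG n)" for n
    unfolding VSPG_def using group.LERF_subgroup[OF group_VSG that] group_hom.subgroup_kernel[OF group_hom_braid_perm(2)] .
  show ?thesis
  proof (cases "n = 2")
    case True
    then show ?thesis using LERF_VB_2 LERF_VSG_2 VP VSPG by simp
  next
    case False
    then have "n \<ge> 3" using assms by simp
    then show ?thesis using False not_LERF_VP not_LERF_VSPG VP VSPG by blast
  qed
qed

end
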